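(* For every $t\in\mathbb Q$ and every real $\rho>0$, $$\mathsf P_{t,\rho}(N)\leqslant N^{3/4+o(1)}+N^{1-1/\rho+o(1)},\qquad N\to\infty.$$
   Context: Let $\mathbf e(z)=\exp(2\pi i z)$, $\mathsf T_2=[0,1]^2$, and for real $x,y$ and a positive integer $N$ let $G(x,y;N)=\sum_{n=1}^N\mathbf e(xn+yn^2)$. For $t\in\mathbb R$ let $\pi_t:\mathbb R^2\to\mathbb R$, $\pi_t(x,y)=x+ty$, and define $$\mathsf P_{t,\rho}(N)=\Big(\int_{\mathbb R}\sup_{(x,y)\in\pi_t^{-1}(z)\cap\mathsf T_2}|G(x,y;N)|^\rho\,dz\Big)^{1/\rho},$$ where the supremum over the empty set is $0$. The notation $F(N)\leqslant N^{a+o(1)}+N^{b+o(1)}$ means: for every $\varepsilon>0$, $F(N)\leqslant N^{a+\varepsilon}+N^{b+\varepsilon}$ for all sufficiently large $N$ (depending on $\varepsilon$, $t$ and $\rho$). *)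

theory Defs
  imports "HOL-Analysis.Analysis"
begin

definition e_fun :: "real \<Rightarrow> complex" where
  "e_fun z = exp (2 * complex_of_real pi * \<i> * complex_of_real z)"

definition gauss_sum :: "real \<Rightarrow> real \<Rightarrow> nat \<Rightarrow> complex" where
  "gauss_sum x y N = (\<Sum>n=1..N. e_fun (x * real n + y * (real n)\<^sup>2))"

definition T2 :: "(real \<times> real) set" where
  "T2 = {0..1} \<times> {0..1}"

definition proj :: "real \<Rightarrow> real \<times> real \<Rightarrow> real" where
  "proj t = (\<lambda>(x, y). x + t * y)"

definition slice :: "real \<Rightarrow> real \<Rightarrow> (real \<times> real) set" where
  "slice t z = proj t -` {z} \<inter> T2"

text \<open>The real supremum of the empty set is unspecified in HOL, so the convention that it
  is 0 is built in explicitly.\<close>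

definition slice_sup :: "real \<Rightarrow> real \<Rightarrow> nat \<Rightarrow> real \<Rightarrow> real" where
  "slice_sup t \<rho> N z =
     (if slice t z = {} then 0
      else (SUP (x, y)\<in>slice t z. norm (gauss_sum x y N) powr \<rho>))"

definition P_norm :: "real \<Rightarrow> real \<Rightarrow> nat \<Rightarrow> real" where
  "P_norm t \<rho> N = (\<integral>z. slice_sup t \<rho> N z \<partial>lborel) powr (1 / \<rho>)"

text \<open>The suprema are attained and the integrand is Lebesgue integrable, so neither \<^const>\<open>Sup\<close>
  nor the Bochner integral takes a default value in the definitions above.\<close>

lemma continuous_on_gauss_sum_powr:
  assumes "\<rho> > 0"
  shows "continuous_on A (\<lambda>(x, y). norm (gauss_sum x y N) powr \<rho>)"
  unfolding gauss_sum_def e_fun_def case_prod_unfold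
  using assms by (intro continuous_intros continuous_on_powr') auto

lemma compact_T2: "compact T2"
  unfolding T2_def by (intro compact_Times) auto

lemma continuous_on_proj: "continuous_on A (proj t)"
  unfolding proj_def case_prod_unfold by (intro continuous_intros)

lemma compact_slice: "compact (slice t z)"
proof -
  have "closed (proj t -` {z})"
    using continuous_on_proj[of UNIV t] by (intro closed_vimage) auto
  then show ?thesis
    unfolding slice_def by (intro closed_Int_compact compact_T2)
qed

lemma slice_sup_attained:
  assumes "\<rho> > 0" and "slice t z \<noteq> {}"
  obtains x y where "(x, y) \<in> slice t z"
    and "slice_sup t \<rho> N z = norm (gauss_sum x y N) powr \<rho>"
    and "\<And>x' y'. (x', y') \<in> slice t z \<Longrightarrow>
           norm (gauss_sum x' y' N) powr \<rho> \<le> norm (gauss_sum x y N) powr \<rho>"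
proof -
  let ?f = "\<lambda>(x, y). norm (gauss_sum x y N) powr \<rho>"
  obtain p where p: "p \<in> slice t z" "\<And>q. q \<in> slice t z \<Longrightarrow> ?f q \<le> ?f p"
    using continuous_attains_sup[OF compact_slice assms(2) continuous_on_gauss_sum_powr[OF assms(1)]]
    by blast
  have "(SUP q\<in>slice t z. ?f q) = ?f p"
    using p by (intro cSup_eq_maximum) auto
  then have "slice_sup t \<rho> N z = ?f p"
    using assms(2) by (simp add: slice_sup_def)
  then show ?thesis
    using p that[of "fst p" "snd p"] by (force simp: case_prod_unfold)
qed

lemma slice_sup_nonneg:
  assumes "\<rho> > 0"
  shows "slice_sup t \<rho> N z \<ge> 0"
proof (cases "slice t z = {}")
  case False
  then show ?thesis using slice_sup_attained[OF assms False, of N] by (metis powr_ge_zero)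
qed (simp add: slice_sup_def)

lemma slice_sup_superlevel:
  assumes "\<rho> > 0" "c > 0"
  shows "{z. c \<le> slice_sup t \<rho> N z} =
    proj t ` {p \<in> T2. c \<le> (\<lambda>(x, y). norm (gauss_sum x y N) powr \<rho>) p}" (is "?L = ?R")
proof (intro equalityI subsetI)
  fix z assume "z \<in> ?L"
  then have z: "c \<le> slice_sup t \<rho> N z" by simp
  with assms(2) have ne: "slice t z \<noteq> {}" by (auto simp: slice_sup_def)
  obtain x y where "(x, y) \<in> slice t z" "slice_sup t \<rho> N z = norm (gauss_sum x y N) powr \<rho>"
    using slice_sup_attained[OF assms(1) ne, of N] by metis
  with z show "z \<in> ?R" by (force simp: slice_def)
next
  fix z assume "z \<in> ?R"
  then obtain x y where xy: "(x, y) \<in> T2" "c \<le> norm (gauss_sum x y N) powr \<rho>" "z = proj t (x, y)"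
    by auto
  then have s: "(x, y) \<in> slice t z" by (simp add: slice_def)
  then have ne: "slice t z \<noteq> {}" by auto
  have "norm (gauss_sum x y N) powr \<rho> \<le> slice_sup t \<rho> N z"
    using slice_sup_attained[OF assms(1) ne, of N] s by metis
  with xy show "z \<in> ?L" by simp
qed

lemma borel_measurable_slice_sup:
  assumes "\<rho> > 0"
  shows "slice_sup t \<rho> N \<in> borel_measurable borel"
proof -
  have "{z. c \<le> slice_sup t \<rho> N z} \<in> sets borel" for c
  proof (cases "c > 0")
    case True
    let ?f = "\<lambda>(x, y). norm (gauss_sum x y N) powr \<rho>"
    have "closed {p. c \<le> ?f p}"
      using continuous_on_gauss_sum_powr[OF assms, of UNIV N]
      by (intro closed_Collect_le) (auto simp: case_prod_unfold)
    then have "compact (T2 \<inter> {p. c \<le> ?f p})"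
      by (intro compact_Int_closed compact_T2)
    then have "compact {p \<in> T2. c \<le> ?f p}" by (simp add: Int_def)
    then have "compact (proj t ` {p \<in> T2. c \<le> ?f p})"
      by (intro compact_continuous_image continuous_on_proj)
    then show ?thesis
      unfolding slice_sup_superlevel[OF assms True] by (rule borel_compact)
  next
    case False
    then have "{z. c \<le> slice_sup t \<rho> N z} = UNIV"
      using slice_sup_nonneg[OF assms, of t N] by (auto intro: order_trans[of c 0])
    then show ?thesis by simp
  qed
  then show ?thesis by (simp add: borel_measurable_iff_ge)
qed

lemma integrable_slice_sup:
  assumes "\<rho> > 0"
  shows "integrable lborel (slice_sup t \<rho> N)"
proof -
  let ?f = "\<lambda>(x, y). norm (gauss_sum x y N) powr \<rho>"
  have "compact (?f ` T2)" "compact (proj t ` T2)"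
    by (intro compact_continuous_image compact_T2 continuous_on_proj
        continuous_on_gauss_sum_powr assms)+
  then have "bounded (?f ` T2)" "bounded (proj t ` T2)"
    by (auto intro: compact_imp_bounded)
  then obtain B R where B: "\<And>p. p \<in> T2 \<Longrightarrow> norm (?f p) \<le> B"
    and R: "\<And>p. p \<in> T2 \<Longrightarrow> norm (proj t p) \<le> R"
    unfolding bounded_iff by (metis (no_types, lifting) image_eqI)
  have bd: "norm (slice_sup t \<rho> N z) \<le> norm (B * indicator {-R..R} z)" for z
  proof (cases "slice t z = {}")
    case False
    obtain x y where xy: "(x, y) \<in> slice t z" "slice_sup t \<rho> N z = norm (gauss_sum x y N) powr \<rho>"
      using slice_sup_attained[OF assms False, of N] by metis
    then have "(x, y) \<in> T2" "z = proj t (x, y)" by (auto simp: slice_def)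
    with B[of "(x, y)"] R[of "(x, y)"] xy show ?thesis by (auto simp: indicator_def)
  qed (simp add: slice_sup_def)
  show ?thesis
  proof (rule Bochner_Integration.integrable_bound)
    show "integrable lborel (\<lambda>z. B * indicator {-R..R} z :: real)"
      by (intro integrable_mult_right) (simp add: integrable_indicator_iff emeasure_lborel_Icc_eq)
    show "slice_sup t \<rho> N \<in> borel_measurable lborel"
      using borel_measurable_slice_sup[OF assms] by simp
  qed (use bd in auto)
qed

end

theory Submission
  imports Defs "HOL-Real_Asymp.Real_Asymp"
begin

text \<open>
  Up to a unimodular factor the sum is \<open>\<Sum>\<^sub>n e(X n + Y n(n-1)/2)\<close> with \<open>X = x + 3y\<close>, \<open>Y = 2y\<close>. Suppose
  its modulus is at least \<open>A\<close>, and approximate \<open>Y = a/q + O(1/(qQ))\<close> by Dirichlet with \<open>Q\<close>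
  slightly smaller than \<open>A\<^sup>2\<close>. After squaring out, the pairs \<open>m, n\<close> that are incongruent modulo \<open>q\<close>
  contribute \<open>O(Q log Q)\<close>, so the sum over congruent pairs, which is the sum over residue
  classes of the squared moduli of the partial sums, has order at least \<open>A\<^sup>2\<close>. Trivially this gives
  \<open>q = O(N\<^sup>2/A\<^sup>2)\<close>; and within a residue class the phase is almost linear, so that it also forces
  \<open>qX + a(q-1)/2\<close> to be within \<open>O(N/Q)\<close> of an integer.

  For \<open>t = p/s\<close> it follows that \<open>z = x + t y\<close> lies within \<open>O(N/(qQ))\<close> of a rational with denominator
  \<open>2qs\<close>. Only \<open>O(q)\<close> such rationals occur for each \<open>q\<close>, so the set of those \<open>z\<close> has measure
  \<open>O(N\<^sup>2/A\<^sup>2 \<sqdot> N/Q) = N\<^sup>3\<^sup>+\<^sup>o\<^sup>(\<^sup>1\<^sup>)/A\<^sup>4\<close>. Integrating \<open>A\<^sup>\<rho>\<close> against this weak \<open>L\<^sup>4\<close> bound over \<open>N\<^sup>3\<^sup>/\<^sup>4 \<le> A \<le> N\<close>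
  gives the theorem.
\<close>

section \<open>The character \<open>e_fun\<close> and Kusmin--Landau estimates\<close>

lemma e_fun_eq_cis: "e_fun z = cis (2 * pi * z)"
  by (simp add: e_fun_def cis_conv_exp mult_ac)

lemma e_fun_add: "e_fun (x + y) = e_fun x * e_fun y"
  by (simp add: e_fun_eq_cis cis_mult distrib_left)

lemma norm_e_fun [simp]: "norm (e_fun z) = 1"
  by (simp add: e_fun_eq_cis)

lemma e_fun_of_int [simp]: "e_fun (of_int k) = 1"
  by (simp add: e_fun_eq_cis cis_multiple_2pi)

lemma e_fun_cong_int:
  assumes "x - y \<in> \<int>"
  shows "e_fun x = e_fun y"
proof -
  obtain k where "x = y + of_int k"
    using assms by (metis Ints_cases add.commute diff_add_cancel)
  then show ?thesis by (simp add: e_fun_add)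
qed

lemma cnj_e_fun: "cnj (e_fun x) = e_fun (- x)"
  by (simp add: e_fun_eq_cis cis_cnj)

lemma norm_one_minus_e_fun: "norm (1 - e_fun u) = 2 * \<bar>sin (pi * u)\<bar>"
proof -
  have "norm (1 - e_fun u) = norm (exp (\<i> * of_real (2 * pi * u)) - 1)"
    by (subst norm_minus_commute) (simp add: e_fun_eq_cis cis_conv_exp)
  then show ?thesis by (simp only: dist_exp_i_1) simp
qed

lemma norm_e_fun_diff_le: "norm (e_fun x - e_fun y) \<le> 2 * pi * \<bar>x - y\<bar>"
proof -
  have "e_fun x - e_fun y = e_fun x * (1 - e_fun (y - x))"
    using e_fun_add[of x "y - x"] by (simp add: algebra_simps)
  then have "norm (e_fun x - e_fun y) = 2 * \<bar>sin (pi * (y - x))\<bar>"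
    by (simp add: norm_mult norm_one_minus_e_fun)
  also have "\<dots> \<le> 2 * \<bar>pi * (y - x)\<bar>"
    using abs_sin_x_le_abs_x by (intro mult_left_mono) auto
  finally show ?thesis by (simp add: abs_mult abs_minus_commute)
qed

text \<open>A weak Jordan inequality. Up to 1/3 the mean value theorem gives
  \<open>sin v \<ge> v * cos v \<ge> v / 2\<close> for \<open>v = pi * u\<close>; from 1/3 on,
  monotonicity already gives at least \<open>sqrt 3 / 2\<close>.\<close>

lemma sin_pi_mult_ge:
  assumes "0 \<le> u" "u \<le> 1/2"
  shows "u \<le> sin (pi * u)"
proof (cases "u \<le> 1/3")
  case True
  have "pi * u * cos (pi * u) \<le> sin (pi * u)"
  proof (cases "u = 0")
    case False
    have "\<exists>z>0. z < pi * u \<and> sin (pi * u) - sin 0 = (pi * u - 0) * cos z"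
      using False assms by (intro MVT2) (auto intro!: derivative_eq_intros)
    then obtain z where z: "z > 0" "z < pi * u" "sin (pi * u) = pi * u * cos z" by auto
    have "pi * u \<le> pi" using assms by simp
    then have "cos (pi * u) \<le> cos z" using z by (intro cos_monotone_0_pi_le) auto
    then show ?thesis using z assms by (simp add: mult_left_mono)
  qed simp
  moreover have "cos (pi / 3) \<le> cos (pi * u)"
    using True assms by (intro cos_monotone_0_pi_le) auto
  then have "pi * u * (1/2) \<le> pi * u * cos (pi * u)"
    using assms by (intro mult_left_mono) (auto simp: cos_60)
  moreover have "2 * u \<le> pi * u" using pi_gt3 assms by (intro mult_right_mono) auto
  ultimately show ?thesis by linarith
next
  case False
  have "sin (pi / 3) \<le> sin (pi * u)"
    using False assms by (intro sin_monotone_2pi_le) (auto simp: field_simps)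
  moreover have "sqrt 3 \<ge> 1" by simp
  ultimately show ?thesis using assms unfolding sin_60 by linarith
qed

text \<open>Turns distance from the integers into the separation \<open>d\<close> that the partial
  summation below requires. The half \<open>u > 1/2\<close> is reflected to
  \<open>1 - u\<close>.\<close>

lemma norm_one_minus_e_fun_ge:
  assumes "d \<le> u" "u \<le> 1 - d" "d \<ge> 0"
  shows "2 * d \<le> norm (1 - e_fun u)"
proof (cases "u \<le> 1/2")
  case True
  then show ?thesis
    using sin_pi_mult_ge[of u] assms by (simp add: norm_one_minus_e_fun)
next
  case False
  have "sin (pi * (1 - u)) = sin (pi * u)"
    by (simp add: right_diff_distrib)
  then show ?thesis
    using sin_pi_mult_ge[of "1 - u"] assms False by (simp add: norm_one_minus_e_fun)
qed

lemma norm_one_minus_e_fun_minus: "norm (1 - e_fun (- u)) = norm (1 - e_fun u)"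
  by (simp add: norm_one_minus_e_fun)

text \<open>Kusmin--Landau by partial summation: with \<open>c\<^sub>k = 1 / (1 - w\<^sub>k)\<close> one has
  \<open>a\<^sub>k = c\<^sub>k (a\<^sub>k - a\<^sub>k\<^sub>+\<^sub>1)\<close>, and for slowly varying ratios \<open>w\<^sub>k\<close> no monotonicity is needed.\<close>

lemma norm_sum_slow_ratio_le:
  fixes a w :: "nat \<Rightarrow> complex"
  assumes a: "\<And>k. norm (a k) = 1" and step: "\<And>k. a (Suc k) = a k * w k"
    and d: "d > 0" "\<And>k. k \<le> K \<Longrightarrow> d \<le> norm (1 - w k)"
    and \<eta>: "\<And>k. norm (w (Suc k) - w k) \<le> \<eta>"
  shows "norm (\<Sum>k<K. a k) \<le> 2 / d + real K * \<eta> / d\<^sup>2"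
proof -
  define c where "c k = 1 / (1 - w k)" for k
  have c: "norm (c k) \<le> 1 / d" if "k \<le> K" for k
    using d(2)[OF that] d(1) by (simp add: c_def norm_divide frac_le)
  have cc: "norm (c (Suc k) - c k) \<le> \<eta> / d\<^sup>2" if "Suc k \<le> K" for k
  proof -
    have n: "d \<le> norm (1 - w k)" "d \<le> norm (1 - w (Suc k))" using d(2) that by auto
    then have "1 - w k \<noteq> 0" "1 - w (Suc k) \<noteq> 0" using d(1) by auto
    then have "c (Suc k) - c k = (w (Suc k) - w k) / ((1 - w (Suc k)) * (1 - w k))"
      by (simp add: c_def field_simps)
    then have "norm (c (Suc k) - c k) =
        norm (w (Suc k) - w k) / (norm (1 - w (Suc k)) * norm (1 - w k))"
      by (simp add: norm_divide norm_mult)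
    also have "\<dots> \<le> \<eta> / (d * d)"
      using n d(1) \<eta>[of k] order_trans[OF norm_ge_zero \<eta>[of k]]
      by (intro frac_le mult_mono) auto
    finally show ?thesis by (simp add: power2_eq_square)
  qed
  \<comment> \<open>Carrying the boundary term \<open>a J * c J\<close> through the induction makes
    each step cost only the increment of \<open>c\<close>, because \<open>a\<close> is unimodular.
    Removing it at \<open>J = K\<close> costs a second \<open>1 / d\<close>.\<close>
  have S: "norm ((\<Sum>k<J. a k) + a J * c J) \<le> 1 / d + real J * (\<eta> / d\<^sup>2)" if "J \<le> K" for J
    using that
  proof (induction J)
    case 0
    then show ?case using c[of 0] a by (simp add: norm_mult)
  next
    case (Suc J)
    have "1 - w J \<noteq> 0" using d(2)[of J] d(1) Suc.prems by auto
    then have "c J - 1 = w J * c J" by (simp add: c_def field_simps)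
    then have "a J * c J - a J = a (Suc J) * c J"
      by (metis (no_types, lifting) step mult.assoc mult.right_neutral right_diff_distrib)
    then have "(\<Sum>k<Suc J. a k) + a (Suc J) * c (Suc J) =
        ((\<Sum>k<J. a k) + a J * c J) + a (Suc J) * (c (Suc J) - c J)"
      by (simp add: algebra_simps)
    then have "norm ((\<Sum>k<Suc J. a k) + a (Suc J) * c (Suc J)) \<le>
        norm ((\<Sum>k<J. a k) + a J * c J) + norm (c (Suc J) - c J)"
      by (metis (no_types, lifting) a mult_1 norm_mult norm_triangle_ineq)
    also have "\<dots> \<le> 1 / d + real J * (\<eta> / d\<^sup>2) + \<eta> / d\<^sup>2"
      using Suc cc[of J] by (intro add_mono) auto
    finally show ?case by (simp add: algebra_simps add_divide_distrib)
  qed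
  have "norm (\<Sum>k<K. a k) \<le> norm ((\<Sum>k<K. a k) + a K * c K) + norm (a K * c K)"
    by (metis add_diff_cancel norm_triangle_ineq4)
  also have "\<dots> \<le> 1 / d + real K * (\<eta> / d\<^sup>2) + 1 / d"
    using S[of K] c[of K] a by (intro add_mono) (auto simp: norm_mult)
  finally show ?thesis by simp
qed

text \<open>The ratio is constant, so \<open>\<eta> = 0\<close> and the bound does not grow with
  \<open>K\<close>.\<close>

lemma norm_sum_geometric_e_fun_le:
  assumes "d > 0" "d \<le> norm (1 - e_fun u)"
  shows "norm (\<Sum>k<K. e_fun (v + u * real k)) \<le> 2 / d"
proof -
  have "norm (\<Sum>k<K. e_fun (v + u * real k)) \<le> 2 / d + real K * 0 / d\<^sup>2"
    using assms
    by (intro norm_sum_slow_ratio_le[where w = "\<lambda>_. e_fun u"])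
       (auto simp: e_fun_add[symmetric] algebra_simps)
  then show ?thesis by simp
qed

text \<open>The harmonic numbers minus the logarithm decrease from the value 1 at
  \<open>n = 1\<close>; the \<open>max\<close> covers the empty sum.\<close>

lemma sum_inverse_le_ln:
  "(\<Sum>k=1..n. 1 / real k) \<le> 1 + ln (real (max n 1))"
proof -
  have "harm (Suc m) \<le> 1 + ln (real (Suc m))" for m
  proof -
    have "harm (Suc m) - ln (Suc m) \<le> harm (Suc 0) - ln (Suc 0)"
      using decseqD[OF decseq_harm_diff_ln, of 0 m] by simp
    then show ?thesis by (simp add: harm_def)
  qed
  from this[of "n - 1"] show ?thesis
    by (cases n) (auto simp: harm_def inverse_eq_divide)
qed

section \<open>The quadratic phase and squaring out by residue classes\<close>

text \<open>With the binomial coefficient \<open>n\<close> choose 2 instead of a square, the first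
  difference is \<open>X + Y * n\<close> and the second is \<open>Y\<close>, so a rational
  approximation to \<open>Y\<close> itself enters.\<close>

definition quad_phase :: "real \<Rightarrow> real \<Rightarrow> nat \<Rightarrow> real" where
  "quad_phase X Y n = X * real n + Y * (real n * (real n - 1) / 2)"

text \<open>Starting the index at 0 splits off the constant phase \<open>x + y\<close>. Of the
  coefficient \<open>3 * y\<close>, the shift contributes \<open>2 * y\<close> and rewriting the
  square as \<open>n * (n - 1) + n\<close> contributes \<open>y\<close>.\<close>

lemma norm_gauss_sum_eq_quad_phase:
  "norm (gauss_sum x y N) = norm (\<Sum>n<N. e_fun (quad_phase (x + 3 * y) (2 * y) n))"
proof -
  have "gauss_sum x y N = (\<Sum>n<N. e_fun (x * real (Suc n) + y * (real (Suc n))\<^sup>2))"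
    unfolding gauss_sum_def by (simp add: sum.atLeast1_atMost_eq)
  also have "\<dots> = (\<Sum>n<N. e_fun (x + y) * e_fun (quad_phase (x + 3 * y) (2 * y) n))"
    unfolding e_fun_add[symmetric]
    by (intro sum.cong refl arg_cong[where f = e_fun])
       (simp add: quad_phase_def power2_eq_square field_simps)
  finally show ?thesis by (simp add: sum_distrib_left[symmetric] norm_mult)
qed

text \<open>Weyl differencing: the terms quadratic in \<open>k\<close> cancel, which leaves a
  geometric progression along pairs of fixed difference.\<close>

lemma quad_phase_shift_diff:
  "quad_phase X Y (m + k) - quad_phase X Y (n + k) =
    (quad_phase X Y m - quad_phase X Y n) + Y * (real m - real n) * real k"
  by (simp add: quad_phase_def field_simps)

text \<open>In the expanded square, the pairs congruent to a given \<open>r\<close> form the product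
  \<open>C r \<times> C r\<close>, and their sum is a squared modulus.\<close>

lemma norm_sum_sq_le_residue_classes:
  fixes c :: "nat \<Rightarrow> complex"
  assumes "q > 0"
  shows "(norm (\<Sum>n<N. c n))\<^sup>2 \<le> (\<Sum>r<q. (norm (\<Sum>n\<in>{n\<in>{..<N}. n mod q = r}. c n))\<^sup>2) +
    norm (\<Sum>(m, n)\<in>{(m, n)\<in>{..<N} \<times> {..<N}. m mod q \<noteq> n mod q}. c m * cnj (c n))"
proof -
  define F where "F = (\<lambda>(m, n). c m * cnj (c n))"
  define P where "P = {..<N} \<times> {..<N}"
  define D where "D = {(m, n)\<in>P. m mod q = n mod q}"
  define R where "R = {(m, n)\<in>P. m mod q \<noteq> n mod q}"
  define C where "C r = {n\<in>{..<N}. n mod q = r}" for r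
  have [simp]: "finite P" "finite (C r)" for r by (auto simp: P_def C_def)
  have P: "P = D \<union> R" "D \<inter> R = {}" by (auto simp: D_def R_def)
  have [simp]: "finite D" "finite R"
    by (auto simp: D_def R_def intro: finite_subset[OF _ \<open>finite P\<close>])
  have DC: "{p\<in>D. fst p mod q = r} = C r \<times> C r" for r
    by (auto simp: D_def P_def C_def)
  have "(norm (\<Sum>n<N. c n))\<^sup>2 = norm ((\<Sum>n<N. c n) * cnj (\<Sum>n<N. c n))"
    by (simp add: norm_mult power2_eq_square del: cnj_sum)
  also have "(\<Sum>n<N. c n) * cnj (\<Sum>n<N. c n) = sum F P"
    by (simp add: sum_product sum.cartesian_product F_def P_def)
  also have "\<dots> = sum F D + sum F R"
    unfolding P(1) using P(2) by (intro sum.union_disjoint) auto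
  also have "sum F D = (\<Sum>r<q. sum F {p\<in>D. fst p mod q = r})"
    using assms by (intro sum.group[symmetric]) auto
  also have "\<dots> = (\<Sum>r<q. (\<Sum>n\<in>C r. c n) * cnj (\<Sum>n\<in>C r. c n))"
    by (simp add: DC sum_product sum.cartesian_product F_def)
  also have "norm (\<dots> + sum F R) \<le> (\<Sum>r<q. norm ((\<Sum>n\<in>C r. c n) * cnj (\<Sum>n\<in>C r. c n))) + norm (sum F R)"
    by (rule order_trans[OF norm_triangle_ineq]) (intro add_right_mono norm_sum)
  also have "(\<Sum>r<q. norm ((\<Sum>n\<in>C r. c n) * cnj (\<Sum>n\<in>C r. c n))) = (\<Sum>r<q. (norm (\<Sum>n\<in>C r. c n))\<^sup>2)"
    by (simp add: norm_mult power2_eq_square del: cnj_sum)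
  finally show ?thesis by (simp add: C_def F_def R_def P_def)
qed

section \<open>The contribution of incongruent pairs\<close>

text \<open>The parameter is \<open>k = min m n\<close>; the two offsets treat both signs of
  \<open>h\<close> at once. For \<open>\<bar>h\<bar> \<ge> N\<close> the truncated subtraction makes
  the range empty, as it should be.\<close>

lemma pairs_with_difference_eq:
  fixes h :: int
  shows "{(m, n)\<in>{..<N} \<times> {..<N}. int m - int n = h} =
    (\<lambda>k. (nat (max 0 h) + k, nat (max 0 (- h)) + k)) ` {..<N - nat \<bar>h\<bar>}" (is "?L = ?R")
proof (intro equalityI subsetI)
  fix p assume "p \<in> ?L"
  then obtain m n where p: "p = (m, n)" "m < N" "n < N" "int m - int n = h" by auto
  show "p \<in> ?R"
    using p by (intro image_eqI[where x = "min m n"]) (auto simp: max_def min_def)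
qed (auto simp: max_def)

lemma norm_sum_fixed_difference_le:
  fixes h :: int
  assumes "d > 0" "d \<le> norm (1 - e_fun (Y * of_int h))"
  shows "norm (\<Sum>(m, n)\<in>{(m, n)\<in>{..<N} \<times> {..<N}. int m - int n = h}.
    e_fun (quad_phase X Y m) * cnj (e_fun (quad_phase X Y n))) \<le> 2 / d"
proof -
  define m0 n0 where "m0 = nat (max 0 h)" and "n0 = nat (max 0 (- h))"
  have h: "real m0 - real n0 = of_int h" by (auto simp: m0_def n0_def max_def)
  have "(\<Sum>(m, n)\<in>{(m, n)\<in>{..<N} \<times> {..<N}. int m - int n = h}.
      e_fun (quad_phase X Y m) * cnj (e_fun (quad_phase X Y n))) =
    (\<Sum>k<N - nat \<bar>h\<bar>. e_fun (quad_phase X Y (m0 + k)) * cnj (e_fun (quad_phase X Y (n0 + k))))"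
    unfolding pairs_with_difference_eq m0_def n0_def
    by (subst sum.reindex) (auto simp: inj_on_def)
  also have "\<dots> = (\<Sum>k<N - nat \<bar>h\<bar>. e_fun ((quad_phase X Y m0 - quad_phase X Y n0) + Y * of_int h * real k))"
    unfolding cnj_e_fun e_fun_add[symmetric] h[symmetric] quad_phase_shift_diff[symmetric] by simp
  finally show ?thesis
    using norm_sum_geometric_e_fun_le[OF assms] by simp
qed

text \<open>Modulo 1, \<open>Y * h\<close> equals \<open>(r + b) / q\<close> with
  \<open>\<bar>b\<bar> \<le> 1/2\<close>. Since \<open>r\<close> and \<open>q - r\<close> are at
  least 1, the error \<open>b\<close> consumes at most half of their minimum, and the chord bound
  restores this factor 2.\<close>

lemma norm_one_minus_e_fun_near_rational:
  fixes a h :: int and q :: nat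
  assumes q: "q > 0" and \<beta>: "\<bar>Y * real q - of_int a\<bar> * \<bar>of_int h\<bar> \<le> 1/2"
    and r: "r = nat ((a * h) mod int q)" "r \<noteq> 0"
  shows "min (real r) (real q - real r) / real q \<le> norm (1 - e_fun (Y * of_int h))"
proof -
  define \<mu> where "\<mu> = min (real r) (real q - real r)"
  define b where "b = (Y * real q - of_int a) * of_int h"
  define u where "u = (real r + b) / real q"
  have ri: "int r = (a * h) mod int q" using r q by simp
  then have rq: "r < q" using q by (metis of_nat_0_less_iff of_nat_less_iff pos_mod_bound)
  have b: "\<bar>b\<bar> \<le> 1/2" using \<beta> by (simp add: b_def abs_mult)
  have \<mu>: "\<mu> \<ge> 1" "\<mu> \<le> real r" "\<mu> \<le> real q - real r" using rq r(2) by (auto simp: \<mu>_def)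
  have "a * h = int q * ((a * h) div int q) + int r" using ri by simp
  then have "of_int (a * h) = real_of_int (int q * ((a * h) div int q) + int r)" by simp
  then have eq: "of_int a * of_int h = real q * of_int ((a * h) div int q) + real r"
    by simp
  have "Y * of_int h - u = (of_int a * of_int h - real r) / real q"
    using q by (simp add: u_def b_def field_simps)
  also have "\<dots> = of_int ((a * h) div int q)" using q by (simp add: eq)
  finally have "Y * of_int h - u \<in> \<int>" by simp
  then have "e_fun (Y * of_int h) = e_fun u" by (rule e_fun_cong_int)
  moreover have "2 * (\<mu> / (2 * real q)) \<le> norm (1 - e_fun u)"
  proof (rule norm_one_minus_e_fun_ge)
    show "\<mu> / (2 * real q) \<le> u" using \<mu> b q by (simp add: u_def field_simps)
    have "u + \<mu> / (2 * real q) = (real r + b + \<mu> / 2) / real q"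
      using q by (simp add: u_def field_simps)
    also have "\<dots> \<le> 1" using \<mu> b q by (subst divide_le_eq_1_pos) auto
    finally show "u \<le> 1 - \<mu> / (2 * real q)" by simp
  qed (use \<mu> in auto)
  ultimately show ?thesis by (simp add: \<mu>_def)
qed

text \<open>As \<open>a\<close> is invertible modulo \<open>q\<close>, all solutions are congruent
  modulo \<open>q\<close>, so each is determined by its quotient by \<open>q\<close>. It remains to
  count quotients.\<close>

lemma card_interval_linear_congruence_le:
  fixes a c :: int and q N :: nat
  assumes "q > 0" "coprime a (int q)"
  shows "real (card {h\<in>{- int N..int N}. (a * h) mod int q = c}) \<le> 2 * real N / real q + 2"
    (is "real (card ?H) \<le> _")
proof -
  let ?I = "{(- int N) div int q..int N div int q}"
  have "inj_on (\<lambda>h. h div int q) ?H"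
  proof (rule inj_onI)
    fix h h' assume hh: "h \<in> ?H" "h' \<in> ?H" "h div int q = h' div int q"
    then have "(a * h) mod int q = (a * h') mod int q" by simp
    then have "int q dvd a * (h - h')" by (simp add: mod_eq_dvd_iff right_diff_distrib)
    then have "int q dvd h - h'"
      using assms(2) by (simp add: coprime_commute coprime_dvd_mult_right_iff)
    then have "h mod int q = h' mod int q" by (simp add: mod_eq_dvd_iff)
    then show "h = h'" using hh(3) by (metis div_mult_mod_eq)
  qed
  moreover have "(\<lambda>h. h div int q) ` ?H \<subseteq> ?I"
    using assms(1) by (auto intro!: zdiv_mono1)
  ultimately have "card ?H \<le> card ?I" by (meson card_inj_on_le finite_atLeastAtMost_int)
  also have "int (card ?I) = int N div int q - (- int N) div int q + 1"
    using zdiv_mono1[of "- int N" "int N" "int q"] assms(1) by simp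
  finally have "real (card ?H) \<le> of_int (int N div int q - (- int N) div int q + 1)"
    by (metis (no_types, lifting) of_int_le_iff of_int_of_nat_eq of_nat_le_iff)
  also have "\<dots> \<le> 2 * real N / real q + 2"
  proof -
    have "of_int (int N div int q) = (of_int \<lfloor>real N / real q\<rfloor> :: real)"
      "of_int ((- int N) div int q) = (of_int \<lfloor>- real N / real q\<rfloor> :: real)"
      using floor_divide_of_int_eq[of "int N" "int q", where ?'a = real]
        floor_divide_of_int_eq[of "- int N" "int q", where ?'a = real] by auto
    moreover have "of_int \<lfloor>real N / real q\<rfloor> \<le> real N / real q"
      "of_int \<lfloor>- real N / real q\<rfloor> > - real N / real q - 1" by linarith+
    moreover have "- real N / real q = - (real N / real q)" "2 * real N / real q = 2 * (real N / real q)"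
      by auto
    ultimately show ?thesis unfolding of_int_add of_int_diff of_int_1 by linarith
  qed
  finally show ?thesis .
qed

lemma sum_inverse_two_sided_le:
  assumes "q > 0"
  shows "(\<Sum>r\<in>{1..<q}. 1 / real r + 1 / (real q - real r)) \<le> 2 * (1 + ln (real q))"
proof -
  have "(\<Sum>r\<in>{1..<q}. 1 / (real q - real r)) = (\<Sum>r\<in>{1..<q}. 1 / real r)"
    by (rule sum.reindex_bij_witness[of _ "\<lambda>r. q - r" "\<lambda>r. q - r"]) (auto simp: of_nat_diff)
  moreover have "(\<Sum>r\<in>{1..<q}. 1 / real r) \<le> (\<Sum>r=1..q. 1 / real r)"
    by (intro sum_mono2) auto
  moreover have "\<dots> \<le> 1 + ln (real q)"
    using sum_inverse_le_ln[of q] assms max_absorb1[of 1 q] by simp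
  ultimately show ?thesis by (simp add: sum.distrib)
qed

text \<open>Pairs are grouped by their difference \<open>h\<close>, and the \<open>h\<close> by the
  nonzero residue \<open>r\<close> of \<open>a * h\<close>. Each \<open>h\<close> costs about
  \<open>q / min r (q - r)\<close>, each \<open>r\<close> occurs \<open>O(N / q + 1)\<close> times,
  and summing over \<open>r\<close> gives the logarithm.\<close>

lemma norm_sum_off_residue_le:
  fixes a :: int and q N Q :: nat
  assumes q: "q > 0" "q \<le> Q" and a: "coprime a (int q)" and N: "2 * N \<le> Q"
    and \<beta>: "\<bar>Y * real q - of_int a\<bar> \<le> 1 / real Q"
  shows "norm (\<Sum>(m, n)\<in>{(m, n)\<in>{..<N} \<times> {..<N}. m mod q \<noteq> n mod q}.
      e_fun (quad_phase X Y m) * cnj (e_fun (quad_phase X Y n))) \<le> 12 * real Q * (1 + ln (real Q))"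
proof -
  define F where "F = (\<lambda>(m, n). e_fun (quad_phase X Y m) * cnj (e_fun (quad_phase X Y n)))"
  define R where "R = {(m, n)\<in>{..<N} \<times> {..<N}. m mod q \<noteq> n mod q}"
  define H where "H = {h\<in>{- int N..int N}. \<not> int q dvd h}"
  \<comment> \<open>This majorises \<open>2 * q / min r (q - r)\<close>: the reciprocal of a minimum
    is at most the sum of both reciprocals.\<close>
  define w where "w r = 2 * real q * (1 / real r + 1 / (real q - real r))" for r
  define \<rho> where "\<rho> h = nat ((a * h) mod int q)" for h
  have fin: "finite R" "finite H"
    by (rule finite_subset[of _ "{..<N} \<times> {..<N}"], auto simp: R_def)
       (rule finite_subset[of _ "{- int N..int N}"], auto simp: H_def)
  have mod: "m mod q = n mod q \<longleftrightarrow> int q dvd int m - int n" for m n :: nat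
    by (metis mod_eq_dvd_iff of_nat_eq_iff zmod_int)
  have \<rho>: "\<rho> h \<in> {1..<q}" if "h \<in> H" for h
  proof -
    have "\<not> int q dvd a * h"
      using a that by (simp add: H_def coprime_commute coprime_dvd_mult_right_iff)
    then have "(a * h) mod int q \<noteq> 0" by (simp add: dvd_eq_mod_eq_0)
    moreover have "0 \<le> (a * h) mod int q" "(a * h) mod int q < int q" using q by auto
    ultimately show ?thesis unfolding \<rho>_def by auto
  qed
  have block: "norm (\<Sum>p\<in>{p\<in>R. int (fst p) - int (snd p) = h}. F p) \<le> w (\<rho> h)" if h: "h \<in> H" for h
  proof -
    let ?r = "\<rho> h"
    have r: "?r \<noteq> 0" "?r < q" using \<rho>[OF h] by auto
    let ?d = "min (real ?r) (real q - real ?r) / real q"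
    have "\<bar>real_of_int h\<bar> \<le> real N" using h by (auto simp: H_def)
    then have "\<bar>Y * real q - of_int a\<bar> * \<bar>of_int h\<bar> \<le> 1 / real Q * real N"
      using \<beta> by (intro mult_mono) auto
    also have "\<dots> \<le> 1 / 2" using N q by (simp add: field_simps)
    finally have d: "?d \<le> norm (1 - e_fun (Y * of_int h))"
      using r by (intro norm_one_minus_e_fun_near_rational[OF q(1)]) (auto simp: \<rho>_def)
    have d0: "?d > 0" using r q by simp
    have eq: "{p\<in>R. int (fst p) - int (snd p) = h} = {(m, n)\<in>{..<N} \<times> {..<N}. int m - int n = h}"
      using h by (auto simp: R_def H_def mod)
    have "norm (\<Sum>p\<in>{p\<in>R. int (fst p) - int (snd p) = h}. F p) \<le> 2 / ?d"
      unfolding F_def eq by (rule norm_sum_fixed_difference_le[OF d0 d])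
    also have "2 / ?d = 2 * real q * (1 / min (real ?r) (real q - real ?r))" by simp
    also have "\<dots> \<le> w ?r"
      unfolding w_def using r by (intro mult_left_mono) (auto simp: min_def)
    finally show ?thesis .
  qed
  have "norm (sum F R) = norm (\<Sum>h\<in>H. \<Sum>p\<in>{p\<in>R. int (fst p) - int (snd p) = h}. F p)"
    by (subst sum.group) (use fin in \<open>auto simp: R_def H_def mod\<close>)
  also have "\<dots> \<le> (\<Sum>h\<in>H. w (\<rho> h))"
    by (intro sum_norm_le block)
  also have "\<dots> = (\<Sum>r\<in>{1..<q}. \<Sum>h\<in>{h\<in>H. \<rho> h = r}. w (\<rho> h))"
    using fin \<rho> by (intro sum.group[symmetric]) auto
  also have "\<dots> = (\<Sum>r\<in>{1..<q}. real (card {h\<in>H. \<rho> h = r}) * w r)"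
    by (intro sum.cong refl) simp
  also have "\<dots> \<le> (\<Sum>r\<in>{1..<q}. (2 * real N / real q + 2) * w r)"
  proof (intro sum_mono mult_right_mono)
    fix r assume r: "r \<in> {1..<q}"
    have "{h\<in>H. \<rho> h = r} \<subseteq> {h\<in>{- int N..int N}. (a * h) mod int q = int r}"
      using q by (auto simp: H_def \<rho>_def)
    moreover have "finite {h\<in>{- int N..int N}. (a * h) mod int q = int r}"
      by (rule finite_subset[of _ "{- int N..int N}"]) auto
    ultimately have "real (card {h\<in>H. \<rho> h = r}) \<le>
        real (card {h\<in>{- int N..int N}. (a * h) mod int q = int r})"
      by (simp add: card_mono)
    then show "real (card {h\<in>H. \<rho> h = r}) \<le> 2 * real N / real q + 2"
      using card_interval_linear_congruence_le[OF q(1) a, of N "int r"] by linarith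
    show "w r \<ge> 0" using r by (auto simp: w_def)
  qed
  also have "\<dots> = (4 * real N + 4 * real q) * (\<Sum>r\<in>{1..<q}. 1 / real r + 1 / (real q - real r))"
  proof -
    have "(2 * real N / real q + 2) * (2 * real q) = 4 * real N + 4 * real q"
      using q by (simp add: field_simps)
    then have "(2 * real N / real q + 2) * w r =
        (4 * real N + 4 * real q) * (1 / real r + 1 / (real q - real r))" for r
      unfolding w_def by (metis mult.assoc)
    then show ?thesis by (simp only: sum_distrib_left)
  qed
  also have "\<dots> \<le> (4 * real N + 4 * real q) * (2 * (1 + ln (real q)))"
    by (intro mult_left_mono sum_inverse_two_sided_le q) auto
  \<comment> \<open>Here \<open>4 * N \<le> 2 * Q\<close> and
    \<open>4 * q \<le> 4 * Q\<close>.\<close>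
  also have "\<dots> \<le> (6 * real Q) * (2 * (1 + ln (real Q)))"
    using q N by (intro mult_mono) (auto simp: ln_ge_zero)
  finally show ?thesis by (simp add: F_def R_def algebra_simps)
qed

section \<open>Sums over a single residue class\<close>

text \<open>The length is the ceiling of \<open>(N - r) / q\<close>, written so that the natural
  subtraction never truncates, even for \<open>r > N\<close>.\<close>

lemma residue_class_eq_image:
  fixes q r N :: nat
  assumes "r < q"
  shows "{n\<in>{..<N}. n mod q = r} = (\<lambda>k. r + q * k) ` {..<(N + q - 1 - r) div q}"
proof -
  have iff: "k < (N + q - 1 - r) div q \<longleftrightarrow> r + q * k < N" for k
    using assms less_eq_div_iff_mult_less_eq[of q "Suc k" "N + q - 1 - r"]
    by (auto simp: Suc_le_eq[symmetric] algebra_simps)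
  show ?thesis
  proof (intro equalityI subsetI)
    fix n assume "n \<in> {n\<in>{..<N}. n mod q = r}"
    then have n: "n = r + q * (n div q)" "n < N" using mod_mult_div_eq[of n q] by auto
    then have "n div q < (N + q - 1 - r) div q" unfolding iff by simp
    then show "n \<in> (\<lambda>k. r + q * k) ` {..<(N + q - 1 - r) div q}"
      using n(1) by blast
  next
    fix n assume "n \<in> (\<lambda>k. r + q * k) ` {..<(N + q - 1 - r) div q}"
    then obtain k where "n = r + q * k" "k < (N + q - 1 - r) div q" by auto
    then show "n \<in> {n\<in>{..<N}. n mod q = r}" using assms unfolding iff by simp
  qed
qed

lemma sum_residue_class_eq:
  fixes c :: "nat \<Rightarrow> complex"
  assumes "r < q"
  shows "(\<Sum>n\<in>{n\<in>{..<N}. n mod q = r}. c n) = (\<Sum>k<(N + q - 1 - r) div q. c (r + q * k))"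
  unfolding residue_class_eq_image[OF assms]
  using assms by (subst sum.reindex) (auto simp: inj_on_def)

lemma card_residue_class_le:
  assumes "r < q"
  shows "real (card {n\<in>{..<N}. n mod q = r}) \<le> real N / real q + 1"
proof -
  have "card {n\<in>{..<N}. n mod q = r} \<le> (N + q - 1 - r) div q"
    unfolding residue_class_eq_image[OF assms]
    using card_image_le[of "{..<(N + q - 1 - r) div q}"] by fastforce
  also have "\<dots> \<le> (N + q) div q" by (intro div_le_mono) simp
  also have "real \<dots> \<le> real (N + q) / real q" by (rule of_nat_div_le_of_nat)
  finally show ?thesis using assms by (simp add: field_simps)
qed

text \<open>One factor of each square is bounded by the largest class size; the other factors add up
  to \<open>N\<close>.\<close>

lemma sum_residue_classes_sq_le:
  fixes c :: "nat \<Rightarrow> complex"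
  assumes "q > 0" "\<And>n. norm (c n) = 1"
  shows "(\<Sum>r<q. (norm (\<Sum>n\<in>{n\<in>{..<N}. n mod q = r}. c n))\<^sup>2) \<le> (real N)\<^sup>2 / real q + real N"
proof -
  define C where "C r = {n\<in>{..<N}. n mod q = r}" for r
  have "(\<Sum>r<q. (norm (\<Sum>n\<in>C r. c n))\<^sup>2) \<le> (\<Sum>r<q. real (card (C r)) * (real N / real q + 1))"
  proof (intro sum_mono)
    fix r assume r: "r \<in> {..<q}"
    have "norm (\<Sum>n\<in>C r. c n) \<le> real (card (C r))"
      using sum_norm_bound[of "C r" c 1] assms(2) by simp
    moreover have "real (card (C r)) \<le> real N / real q + 1"
      unfolding C_def using r by (intro card_residue_class_le) simp
    ultimately show "(norm (\<Sum>n\<in>C r. c n))\<^sup>2 \<le> real (card (C r)) * (real N / real q + 1)"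
      unfolding power2_eq_square by (intro mult_mono) auto
  qed
  also have "\<dots> = real (\<Sum>r<q. card (C r)) * (real N / real q + 1)"
    by (simp add: sum_distrib_right)
  also have "(\<Sum>r<q. card (C r)) = card {..<N}"
  proof -
    have "(\<lambda>n. n mod q) ` {..<N} \<subseteq> {..<q}" using assms(1) by auto
    then show ?thesis
      using sum.group[of "{..<N}" "{..<q}" "\<lambda>n. n mod q" "\<lambda>_. 1::nat"] by (simp add: C_def)
  qed
  finally show ?thesis by (simp add: C_def power2_eq_square algebra_simps)
qed

text \<open>The last summand is an integer and disappears under \<open>e_fun\<close>. The first
  depends on neither \<open>r\<close> nor \<open>k\<close>, so all classes share one main
  frequency.\<close>

lemma quad_phase_class_step:
  fixes Y :: real and a :: int and q r k :: nat
  defines "\<beta> \<equiv> Y * real q - of_int a"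
  shows "quad_phase X Y (r + q * Suc k) - quad_phase X Y (r + q * k) =
    (X * real q + of_int a * (real q - 1) / 2) + \<beta> * (real (r + q * k) + (real q - 1) / 2)
      + of_int (a * int (r + q * k))"
  by (simp add: quad_phase_def \<beta>_def field_simps)

text \<open>Along the class the frequency \<open>g k\<close> differs from \<open>\<theta>\<close> by
  at most \<open>3 * N / Q\<close>, which is less than \<open>\<bar>\<theta>\<bar> / 2\<close>. It
  therefore stays away from the integers and varies slowly, as Kusmin--Landau needs.\<close>

lemma norm_sum_residue_class_le:
  fixes a :: int and q N Q r :: nat
  assumes q: "q > 0" "q \<le> N" and r: "r < q" and Q: "Q > 0"
    and \<beta>: "\<bar>Y * real q - of_int a\<bar> \<le> 1 / real Q"
    and \<theta>: "X * real q + of_int a * (real q - 1) / 2 - \<theta> \<in> \<int>" "\<bar>\<theta>\<bar> \<le> 1/2"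
      "6 * real N / real Q < \<bar>\<theta>\<bar>"
  shows "norm (\<Sum>n\<in>{n\<in>{..<N}. n mod q = r}. e_fun (quad_phase X Y n)) \<le> 6 / \<bar>\<theta>\<bar>"
proof -
  define K where "K = (N + q - 1 - r) div q"
  define b where "b = Y * real q - of_int a"
  define g where "g k = \<theta> + b * (real (r + q * k) + (real q - 1) / 2)" for k
  have \<theta>0: "\<bar>\<theta>\<bar> > 0" using \<theta>(3) by (smt (verit) divide_nonneg_nonneg of_nat_0_le_iff)
  have b: "\<bar>b\<bar> \<le> 1 / real Q" using \<beta> by (simp add: b_def)
  have "q * K \<le> N + q - 1 - r" by (simp add: K_def)
  then have qK: "r + q * K \<le> N + q" using r q by linarith
  have g: "\<bar>g k - \<theta>\<bar> \<le> \<bar>\<theta>\<bar> / 2" if "k \<le> K" for k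
  proof -
    have "r + q * k \<le> r + q * K" using that by simp
    then have "r + q * k \<le> N + q" using qK by linarith
    then have "real (r + q * k) \<le> real (N + q)" by (rule of_nat_mono)
    moreover have "\<bar>u + (v - 1) / 2\<bar> \<le> 3 * w" if "0 \<le> u" "u \<le> w + v" "1 \<le> v" "v \<le> w" for u v w :: real
      using that by (auto simp: abs_le_iff field_simps)
    ultimately have "\<bar>real (r + q * k) + (real q - 1) / 2\<bar> \<le> 3 * real N"
      using q by simp
    then have "\<bar>b\<bar> * \<bar>real (r + q * k) + (real q - 1) / 2\<bar> \<le> 1 / real Q * (3 * real N)"
      using b by (intro mult_mono) auto
    then have "\<bar>g k - \<theta>\<bar> \<le> 1 / real Q * (3 * real N)"
      by (simp add: g_def abs_mult)
    also have "\<dots> \<le> \<bar>\<theta>\<bar> / 2" using \<theta>(3) by simp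
    finally show ?thesis .
  qed
  have "norm (\<Sum>k<K. e_fun (quad_phase X Y (r + q * k))) \<le>
      2 / \<bar>\<theta>\<bar> + real K * (2 * pi * (real q / real Q)) / \<bar>\<theta>\<bar>\<^sup>2"
  proof (rule norm_sum_slow_ratio_le[where w = "\<lambda>k. e_fun (g k)"])
    fix k
    have "quad_phase X Y (r + q * Suc k) - (quad_phase X Y (r + q * k) + g k) =
        (X * real q + of_int a * (real q - 1) / 2 - \<theta>) + of_int (a * int (r + q * k))"
      using quad_phase_class_step[of X Y r q k a] by (simp add: g_def b_def)
    also have "\<dots> \<in> \<int>" using \<theta>(1) by (intro Ints_add Ints_of_int)
    finally show "e_fun (quad_phase X Y (r + q * Suc k)) = e_fun (quad_phase X Y (r + q * k)) * e_fun (g k)"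
      unfolding e_fun_add[symmetric] by (rule e_fun_cong_int)
    have "g (Suc k) - g k = b * real q" by (simp add: g_def algebra_simps)
    then have "norm (e_fun (g (Suc k)) - e_fun (g k)) \<le> 2 * pi * (\<bar>b\<bar> * real q)"
      using norm_e_fun_diff_le[of "g (Suc k)" "g k"] by (simp add: abs_mult)
    also have "\<dots> \<le> 2 * pi * (1 / real Q * real q)"
      using b by (intro mult_left_mono mult_right_mono) auto
    finally show "norm (e_fun (g (Suc k)) - e_fun (g k)) \<le> 2 * pi * (real q / real Q)" by simp
  next
    fix k assume "k \<le> K"
    \<comment> \<open>\<open>\<bar>g k\<bar>\<close> lies between
      \<open>\<bar>\<theta>\<bar> / 2\<close> and \<open>3 * \<bar>\<theta>\<bar> / 2\<close>, and
      the latter is at most \<open>1 - \<bar>\<theta>\<bar> / 2\<close> because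
      \<open>\<bar>\<theta>\<bar> \<le> 1/2\<close>.\<close>
    have "2 * (\<bar>\<theta>\<bar> / 2) \<le> norm (1 - e_fun \<bar>g k\<bar>)"
      using g[OF \<open>k \<le> K\<close>] \<theta>(2) by (intro norm_one_minus_e_fun_ge) linarith+
    then show "\<bar>\<theta>\<bar> \<le> norm (1 - e_fun (g k))"
      using norm_one_minus_e_fun_minus[of "g k"] by (cases "g k \<ge> 0") auto
  qed (use \<theta>0 in auto)
  \<comment> \<open>The total variation of the ratios is controlled by
    \<open>q * K \<le> 2 * N\<close> and \<open>6 * N / Q < \<bar>\<theta>\<bar>\<close>.\<close>
  also have "\<dots> \<le> 2 / \<bar>\<theta>\<bar> + 4 * \<bar>\<theta>\<bar> / \<bar>\<theta>\<bar>\<^sup>2"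
  proof -
    have "r + q * K \<le> 2 * N" using qK q by linarith
    then have "real (q * K) \<le> real (2 * N)" by (intro of_nat_mono) simp
    then have "2 * pi * (real (q * K) / real Q) \<le> 2 * pi * (real (2 * N) / real Q)"
      by (intro mult_left_mono divide_right_mono) auto
    also have "\<dots> \<le> 2 * 4 * (real (2 * N) / real Q)"
      using pi_less_4 by (intro mult_right_mono) auto
    also have "\<dots> \<le> 4 * \<bar>\<theta>\<bar>" using \<theta>(3) by simp
    finally have "real K * (2 * pi * (real q / real Q)) \<le> 4 * \<bar>\<theta>\<bar>" by (simp add: mult_ac)
    then show ?thesis by (intro add_left_mono divide_right_mono) auto
  qed
  also have "\<dots> = 6 / \<bar>\<theta>\<bar>" using \<theta>0 by (simp add: power2_eq_square field_simps)
  finally show ?thesis unfolding sum_residue_class_eq[OF r] K_def .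
qed

section \<open>Large Gauss sums force rational approximations\<close>

text \<open>The size condition on \<open>A\<close> lets incongruent pairs account for at most half
  of \<open>A\<^sup>2\<close>. The lower bound left for \<open>D\<close> is used twice: against the
  trivial estimate it limits \<open>q\<close>, against the Kusmin--Landau estimate it limits
  \<open>\<theta>\<close>.\<close>

lemma large_gauss_sum_rational_approx:
  fixes x y A :: real and N Q :: nat
  assumes N: "N > 0" "2 * N \<le> Q" and A: "A > 0" "24 * real Q * (1 + ln (real Q)) \<le> A\<^sup>2"
    and G: "A \<le> norm (gauss_sum x y N)"
  obtains q :: nat and a b :: int where "q > 0" "real q * A\<^sup>2 \<le> 4 * (real N)\<^sup>2"
    "\<bar>2 * y * real q - of_int a\<bar> \<le> 1 / real Q"
    "\<bar>(x + 3 * y) * real q + of_int a * (real q - 1) / 2 - of_int b\<bar> \<le> 6 * real N / real Q"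
proof -
  define X Y where "X = x + 3 * y" and "Y = 2 * y"
  have Q: "Q > 0" using N by simp
  obtain a k where ak: "coprime a k" "0 < k" "k \<le> int Q" "\<bar>of_int k * Y - of_int a\<bar> < 1 / real Q"
    using Dirichlet_approx_coprime[OF Q, of Y] by metis
  define q where "q = nat k"
  have q: "q > 0" "q \<le> Q" "coprime a (int q)" using ak by (auto simp: q_def)
  have \<beta>: "\<bar>Y * real q - of_int a\<bar> \<le> 1 / real Q" using ak by (simp add: q_def mult.commute)
  define D where "D = (\<Sum>r<q. (norm (\<Sum>n\<in>{n\<in>{..<N}. n mod q = r}. e_fun (quad_phase X Y n)))\<^sup>2)"
  have "A\<^sup>2 \<le> (norm (\<Sum>n<N. e_fun (quad_phase X Y n)))\<^sup>2"
    using G A unfolding norm_gauss_sum_eq_quad_phase X_def Y_def by (intro power_mono) auto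
  also have "\<dots> \<le> D + 12 * real Q * (1 + ln (real Q))"
    unfolding D_def
    by (rule order_trans[OF norm_sum_sq_le_residue_classes[OF q(1)]])
       (intro add_left_mono norm_sum_off_residue_le[OF q N(2) \<beta>])
  finally have D: "A\<^sup>2 / 2 \<le> D" using A(2) by simp
  have "24 * real Q * 1 \<le> 24 * real Q * (1 + ln (real Q))" using Q by (intro mult_left_mono) auto
  then have AQ: "24 * real Q \<le> A\<^sup>2" using A(2) by simp
  have NQ: "2 * real N \<le> real Q" using N by linarith
  have "D \<le> (real N)\<^sup>2 / real q + real N"
    unfolding D_def by (intro sum_residue_classes_sq_le q) auto
  \<comment> \<open>The extra term \<open>N\<close> is harmless, since
    \<open>48 * N \<le> 24 * Q \<le> A\<^sup>2\<close>.\<close>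
  then have "A\<^sup>2 / 4 \<le> (real N)\<^sup>2 / real q" using D AQ NQ by linarith
  then have qA: "real q * A\<^sup>2 \<le> 4 * (real N)\<^sup>2" using q by (simp add: field_simps)
  have "real q * (4 * real N) \<le> real q * A\<^sup>2" using AQ NQ by (intro mult_left_mono) auto
  then have "real q * real N \<le> real N * real N" using qA by (simp add: power2_eq_square)
  then have qN: "q \<le> N" using N by simp
  define v where "v = X * real q + of_int a * (real q - 1) / 2"
  define \<theta> where "\<theta> = v - of_int (round v)"
  have \<theta>: "v - \<theta> \<in> \<int>" "\<bar>\<theta>\<bar> \<le> 1/2"
    using of_int_round_abs_le[of v] by (auto simp: \<theta>_def abs_minus_commute)
  have "\<bar>\<theta>\<bar> \<le> 6 * real N / real Q"
  \<comment> \<open>Otherwise \<open>D \<le> 36 * q / \<theta>\<^sup>2\<close>, and the bound on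
    \<open>q\<close> yields \<open>A\<^sup>2 * \<bar>\<theta>\<bar> \<le> 24 * N\<close>. But
    \<open>A\<^sup>2 \<ge> 24 * Q\<close> and \<open>\<bar>\<theta>\<bar> * Q > 6 * N\<close> make
    the left side exceed \<open>144 * N\<close>.\<close>
  proof (rule ccontr)
    assume "\<not> ?thesis"
    then have big: "6 * real N / real Q < \<bar>\<theta>\<bar>" by simp
    then have \<theta>0: "\<bar>\<theta>\<bar> > 0" by (smt (verit) divide_nonneg_nonneg of_nat_0_le_iff)
    have "D \<le> (\<Sum>r<q. (6 / \<bar>\<theta>\<bar>)\<^sup>2)"
      unfolding D_def
      using norm_sum_residue_class_le[OF q(1) qN _ Q \<beta>, of _ X \<theta>] \<theta> big
      by (intro sum_mono power_mono) (auto simp: v_def)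
    then have "A\<^sup>2 / 2 \<le> real q * (36 / \<bar>\<theta>\<bar>\<^sup>2)" using D by (simp add: power_divide)
    then have "A\<^sup>2 * \<bar>\<theta>\<bar>\<^sup>2 \<le> 72 * real q" using \<theta>0 by (simp add: field_simps)
    then have "A\<^sup>2 * (A\<^sup>2 * \<bar>\<theta>\<bar>\<^sup>2) \<le> A\<^sup>2 * (72 * real q)" by (intro mult_left_mono) auto
    also have "\<dots> \<le> 288 * (real N)\<^sup>2" using qA by simp
    also have "\<dots> \<le> (24 * real N)\<^sup>2" by (simp add: power_mult_distrib)
    finally have "(A\<^sup>2 * \<bar>\<theta>\<bar>)\<^sup>2 \<le> (24 * real N)\<^sup>2" by (simp add: power2_eq_square mult_ac)
    then have "A\<^sup>2 * \<bar>\<theta>\<bar> \<le> 24 * real N" by (rule power2_le_imp_le) simp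
    moreover have "24 * real Q * \<bar>\<theta>\<bar> \<le> A\<^sup>2 * \<bar>\<theta>\<bar>" using AQ by (intro mult_right_mono) auto
    moreover have "6 * real N < \<bar>\<theta>\<bar> * real Q" using big Q by (simp add: field_simps)
    ultimately show False using N by (simp add: mult.commute)
  qed
  then show ?thesis
    using q qA \<beta> that[of q a "round v"] by (simp add: \<theta>_def v_def X_def Y_def)
qed

section \<open>Covering the superlevel sets\<close>

text \<open>About \<open>2 * c * R\<close> intervals of length \<open>2 * \<eta> / c\<close>
  suffice, so \<open>c\<close> cancels. This uniformity makes each denominator \<open>q\<close> cost
  the same.\<close>

lemma near_integer_multiple_cover:
  fixes c R \<eta> :: real
  assumes c: "c \<ge> 1" and R: "R \<ge> 0" and \<eta>: "\<eta> \<ge> 0"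
  obtains U where "U \<in> sets borel" "emeasure lborel U \<le> ennreal ((4 * R + 4 * \<eta> + 2) * \<eta>)"
    "\<And>z m. \<bar>z\<bar> \<le> R \<Longrightarrow> \<bar>c * z - of_int m\<bar> \<le> \<eta> \<Longrightarrow> z \<in> U"
proof -
  define M where "M = \<lfloor>c * R + \<eta>\<rfloor>"
  define V where "V m = {(of_int m - \<eta>) / c..(of_int m + \<eta>) / c}" for m :: int
  define U where "U = (\<Union>m\<in>{- M..M}. V m)"
  have M: "0 \<le> M" "of_int M \<le> c * R + \<eta>"
    using c R \<eta> by (auto simp: M_def)
  have "z \<in> U" if z: "\<bar>z\<bar> \<le> R" "\<bar>c * z - of_int m\<bar> \<le> \<eta>" for z and m :: int
  proof -
    have "\<bar>c * z\<bar> \<le> c * R" using z(1) c by (simp add: abs_mult mult_left_mono)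
    then have "\<bar>of_int m\<bar> \<le> c * R + \<eta>" using z(2) by linarith
    then have "of_int \<bar>m\<bar> \<le> c * R + \<eta>" by simp
    then have "\<bar>m\<bar> \<le> M" unfolding M_def by (simp only: le_floor_iff)
    then have "m \<in> {- M..M}" by auto
    moreover have "z \<in> V m" using z(2) c by (auto simp: V_def field_simps)
    ultimately show ?thesis by (auto simp: U_def)
  qed
  moreover have "U \<in> sets borel" unfolding U_def V_def by (intro sets.finite_UN) auto
  moreover have "emeasure lborel U \<le> ennreal ((4 * R + 4 * \<eta> + 2) * \<eta>)"
  proof -
    have "emeasure lborel U \<le> (\<Sum>m\<in>{- M..M}. emeasure lborel (V m))"
      unfolding U_def by (intro emeasure_subadditive_finite) (auto simp: V_def)
    also have "\<dots> = (\<Sum>m\<in>{- M..M}. ennreal (2 * \<eta> / c))"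
    proof (intro sum.cong refl)
      fix m
      have "(of_int m - \<eta>) / c \<le> (of_int m + \<eta>) / c" using c \<eta> by (intro divide_right_mono) auto
      then have "emeasure lborel (V m) = ennreal ((of_int m + \<eta>) / c - (of_int m - \<eta>) / c)"
        by (simp add: V_def)
      also have "(of_int m + \<eta>) / c - (of_int m - \<eta>) / c = 2 * \<eta> / c"
        by (simp add: diff_divide_distrib[symmetric])
      finally show "emeasure lborel (V m) = ennreal (2 * \<eta> / c)" .
    qed
    also have "\<dots> = ennreal (\<Sum>m\<in>{- M..M}. 2 * \<eta> / c)"
      using c \<eta> by (intro sum_ennreal) auto
    also have "(\<Sum>m\<in>{- M..M}. 2 * \<eta> / c) = of_int (2 * M + 1) * (2 * \<eta> / c)"
      using M(1) by (simp add: algebra_simps)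
    also have "ennreal \<dots> \<le> ennreal ((4 * R + 4 * \<eta> + 2) * \<eta>)"
    proof (rule ennreal_leI)
      have "of_int (2 * M + 1) * (2 * \<eta> / c) \<le> (2 * (c * R + \<eta>) + 1) * (2 * \<eta> / c)"
        using M c \<eta> by (intro mult_right_mono) auto
      also have "\<dots> = 4 * R * \<eta> + (4 * \<eta> + 2) * \<eta> / c" using c by (simp add: field_simps)
      also have "\<dots> \<le> 4 * R * \<eta> + (4 * \<eta> + 2) * \<eta> / 1"
        using c \<eta> by (intro add_left_mono divide_left_mono) auto
      finally show "of_int (2 * M + 1) * (2 * \<eta> / c) \<le> (4 * R + 4 * \<eta> + 2) * \<eta>"
        by (simp add: algebra_simps)
    qed
    finally show ?thesis .
  qed
  ultimately show ?thesis using that by blast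
qed

lemma slice_abs_le:
  assumes "(x, y) \<in> slice t z"
  shows "z = x + t * y" "\<bar>z\<bar> \<le> 1 + \<bar>t\<bar>"
proof -
  have xy: "0 \<le> x" "x \<le> 1" "0 \<le> y" "y \<le> 1" and z: "z = x + t * y"
    using assms by (auto simp: slice_def proj_def T2_def)
  have "\<bar>t * y\<bar> \<le> \<bar>t\<bar> * 1" unfolding abs_mult using xy by (intro mult_left_mono) auto
  then show "z = x + t * y" "\<bar>z\<bar> \<le> 1 + \<bar>t\<bar>" using z xy by auto
qed

text \<open>Eliminating \<open>x\<close> and \<open>y\<close> writes
  \<open>2 * q * s * (x + t * y)\<close> as an integer plus
  \<open>2 * s * \<theta> + s * (t - 3) * \<beta>\<close>. The factor 2 clears
  \<open>(q - 1) / 2\<close>, and \<open>s\<close> clears the denominator of \<open>t\<close>; this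
  is where rationality of \<open>t\<close> enters.\<close>

lemma rational_approx_projection:
  fixes a b p :: int and q s :: nat
  assumes t: "t * real s = of_int p" and N: "N > 0" and Q: "Q > 0"
    and y: "\<bar>2 * y * real q - of_int a\<bar> \<le> 1 / real Q"
    and x: "\<bar>(x + 3 * y) * real q + of_int a * (real q - 1) / 2 - of_int b\<bar> \<le> 6 * real N / real Q"
  shows "\<exists>m::int. \<bar>2 * real q * real s * (x + t * y) - of_int m\<bar>
    \<le> real s * (12 + \<bar>t - 3\<bar>) * (real N / real Q)"
proof -
  define \<theta> where "\<theta> = (x + 3 * y) * real q + of_int a * (real q - 1) / 2 - of_int b"
  define \<beta> where "\<beta> = 2 * y * real q - of_int a"
  define m where "m = - (int s * a * (int q - 1)) + 2 * int s * b + (p - 3 * int s) * a"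
  have "2 * real q * real s * (x + t * y) = of_int m + (2 * real s * \<theta> + real s * (t - 3) * \<beta>)"
    unfolding m_def \<theta>_def \<beta>_def of_int_add of_int_mult of_int_diff of_int_minus t[symmetric]
    by (simp add: field_simps)
  then have "\<bar>2 * real q * real s * (x + t * y) - of_int m\<bar> \<le>
      2 * real s * \<bar>\<theta>\<bar> + real s * \<bar>t - 3\<bar> * \<bar>\<beta>\<bar>"
    using abs_triangle_ineq[of "2 * real s * \<theta>" "real s * (t - 3) * \<beta>"] by (simp add: abs_mult)
  also have "\<dots> \<le> 2 * real s * (6 * real N / real Q) + real s * \<bar>t - 3\<bar> * (real N / real Q)"
  proof (intro add_mono mult_left_mono)
    show "\<bar>\<theta>\<bar> \<le> 6 * real N / real Q" using x by (simp add: \<theta>_def)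
    have "\<bar>\<beta>\<bar> \<le> 1 / real Q" using y by (simp add: \<beta>_def)
    also have "\<dots> \<le> real N / real Q" using N by (intro divide_right_mono) auto
    finally show "\<bar>\<beta>\<bar> \<le> real N / real Q" .
  qed auto
  also have "\<dots> = real s * (12 + \<bar>t - 3\<bar>) * (real N / real Q)" by (simp add: algebra_simps)
  finally show ?thesis by blast
qed

lemma superlevel_cover:
  fixes t :: real
  assumes "t \<in> \<rat>"
  obtains C where "C \<ge> 0" "\<And>N Q A. N > 0 \<Longrightarrow> 2 * N \<le> Q \<Longrightarrow> A > 0 \<Longrightarrow>
    24 * real Q * (1 + ln (real Q)) \<le> A\<^sup>2 \<Longrightarrow>
    \<exists>U\<in>sets borel. emeasure lborel U \<le> ennreal (C * (real N ^ 3 / (A\<^sup>2 * real Q))) \<and>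
      (\<forall>x y z. (x, y) \<in> slice t z \<longrightarrow> A \<le> norm (gauss_sum x y N) \<longrightarrow> z \<in> U)"
proof -
  obtain p :: int and s :: nat where s: "s > 0" "t * real s = of_int p"
  proof -
    obtain i j where ij: "j > 0" "t = of_int i / of_int j" using Rats_cases'[OF assms] by metis
    then have "t * real (nat j) = of_int i" by simp
    then show ?thesis using that[of "nat j" i] ij by simp
  qed
  define R where "R = 1 + \<bar>t\<bar>"
  define \<kappa> where "\<kappa> = real s * (12 + \<bar>t - 3\<bar>)"
  \<comment> \<open>The leading 4 comes from the number \<open>L\<close> of denominators; the rest
    is the measure of one cover with \<open>\<eta>\<close> replaced by \<open>\<kappa>\<close> in
    the bracket.\<close>
  define C where "C = 4 * (4 * R + 4 * \<kappa> + 2) * \<kappa>"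
  have R: "R \<ge> 0" and \<kappa>: "\<kappa> \<ge> 0" by (auto simp: R_def \<kappa>_def)
  show ?thesis
  proof (rule that)
    show "C \<ge> 0" using R \<kappa> by (simp add: C_def)
    fix N Q :: nat and A :: real
    assume N: "N > 0" "2 * N \<le> Q" and A: "A > 0" "24 * real Q * (1 + ln (real Q)) \<le> A\<^sup>2"
    define \<eta> where "\<eta> = \<kappa> * (real N / real Q)"
    have \<eta>: "\<eta> \<ge> 0" using \<kappa> by (simp add: \<eta>_def)
    have "real N / real Q \<le> 1" using N by simp
    then have \<eta>\<kappa>: "\<eta> \<le> \<kappa>" unfolding \<eta>_def using \<kappa> by (rule mult_left_le)
    define L where "L = nat \<lfloor>4 * (real N)\<^sup>2 / A\<^sup>2\<rfloor>"
    have L: "real L \<le> 4 * (real N)\<^sup>2 / A\<^sup>2" by (simp add: L_def)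
    have "\<exists>U. U \<in> sets borel \<and> emeasure lborel U \<le> ennreal ((4 * R + 4 * \<eta> + 2) * \<eta>) \<and>
      (\<forall>z (m::int). \<bar>z\<bar> \<le> R \<longrightarrow> \<bar>2 * real q * real s * z - of_int m\<bar> \<le> \<eta> \<longrightarrow> z \<in> U)"
      if "q \<in> {1..L}" for q
    proof -
      have "1 * 1 \<le> (2 * real q) * real s" using that s by (intro mult_mono) auto
      then have c: "1 \<le> 2 * real q * real s" by simp
      show ?thesis by (rule near_integer_multiple_cover[OF c R \<eta>]) blast
    qed
    then obtain V where V: "\<And>q. q \<in> {1..L} \<Longrightarrow> V q \<in> sets borel"
      "\<And>q. q \<in> {1..L} \<Longrightarrow> emeasure lborel (V q) \<le> ennreal ((4 * R + 4 * \<eta> + 2) * \<eta>)"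
      "\<And>q z m. q \<in> {1..L} \<Longrightarrow> \<bar>z\<bar> \<le> R \<Longrightarrow> \<bar>2 * real q * real s * z - of_int m\<bar> \<le> \<eta> \<Longrightarrow> z \<in> V q"
      by metis
    show "\<exists>U\<in>sets borel. emeasure lborel U \<le> ennreal (C * (real N ^ 3 / (A\<^sup>2 * real Q))) \<and>
      (\<forall>x y z. (x, y) \<in> slice t z \<longrightarrow> A \<le> norm (gauss_sum x y N) \<longrightarrow> z \<in> U)"
    proof (intro bexI[of _ "\<Union>q\<in>{1..L}. V q"] conjI allI impI)
      show "(\<Union>q\<in>{1..L}. V q) \<in> sets borel" using V(1) by (intro sets.finite_UN) auto
      have "emeasure lborel (\<Union>q\<in>{1..L}. V q) \<le> (\<Sum>q\<in>{1..L}. emeasure lborel (V q))"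
        using V(1) by (intro emeasure_subadditive_finite) auto
      also have "\<dots> \<le> (\<Sum>q\<in>{1..L}. ennreal ((4 * R + 4 * \<eta> + 2) * \<eta>))"
        by (intro sum_mono V(2))
      also have "\<dots> = ennreal (\<Sum>q\<in>{1..L}. (4 * R + 4 * \<eta> + 2) * \<eta>)"
        using R \<eta> by (intro sum_ennreal) auto
      also have "(\<Sum>q\<in>{1..L}. (4 * R + 4 * \<eta> + 2) * \<eta>) = real L * ((4 * R + 4 * \<eta> + 2) * \<eta>)"
        by simp
      also have "ennreal \<dots> \<le> ennreal (C * (real N ^ 3 / (A\<^sup>2 * real Q)))"
      proof (rule ennreal_leI)
        have "real L * ((4 * R + 4 * \<eta> + 2) * \<eta>) \<le>
            4 * (real N)\<^sup>2 / A\<^sup>2 * ((4 * R + 4 * \<kappa> + 2) * \<eta>)"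
          using L \<eta>\<kappa> \<eta> R by (intro mult_mono) auto
        also have "\<dots> = C * (real N ^ 3 / (A\<^sup>2 * real Q))"
          by (simp add: C_def \<eta>_def power2_eq_square power3_eq_cube)
        finally show "real L * ((4 * R + 4 * \<eta> + 2) * \<eta>) \<le> C * (real N ^ 3 / (A\<^sup>2 * real Q))" .
      qed
      finally show "emeasure lborel (\<Union>q\<in>{1..L}. V q) \<le> ennreal (C * (real N ^ 3 / (A\<^sup>2 * real Q)))" .
    next
      fix x y z assume xy: "(x, y) \<in> slice t z" and G: "A \<le> norm (gauss_sum x y N)"
      obtain q :: nat and a b :: int where q: "q > 0" "real q * A\<^sup>2 \<le> 4 * (real N)\<^sup>2"
        "\<bar>2 * y * real q - of_int a\<bar> \<le> 1 / real Q"
        "\<bar>(x + 3 * y) * real q + of_int a * (real q - 1) / 2 - of_int b\<bar> \<le> 6 * real N / real Q"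
        using large_gauss_sum_rational_approx[OF N A G] by metis
      have "real q \<le> 4 * (real N)\<^sup>2 / A\<^sup>2" using q(2) A(1) by (simp add: field_simps)
      then have qL: "q \<in> {1..L}" using q(1) by (simp add: L_def le_nat_floor)
      have "Q > 0" using N by simp
      then obtain m :: int where "\<bar>2 * real q * real s * (x + t * y) - of_int m\<bar> \<le> \<eta>"
        using rational_approx_projection[OF s(2) N(1) _ q(3,4)] by (auto simp: \<eta>_def \<kappa>_def)
      then have "z \<in> V q"
        using slice_abs_le[OF xy] by (intro V(3)[OF qL]) (auto simp: R_def)
      then show "z \<in> (\<Union>q\<in>{1..L}. V q)" using qL by blast
    qed
  qed
qed

text \<open>Takes \<open>Q\<close> just below \<open>A\<^sup>2\<close> by a factor
  \<open>N powr \<delta>\<close>, which absorbs the logarithm and accounts for the loss in the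
  exponent.\<close>

lemma superlevel_cover_powr:
  fixes t :: real
  assumes t: "t \<in> \<rat>" and \<delta>: "0 < \<delta>" "\<delta> \<le> 1/4"
  obtains C where "C \<ge> 0" "\<forall>\<^sub>F N in at_top.
    \<forall>A. real N powr (3/4) \<le> A \<longrightarrow> A \<le> real N \<longrightarrow>
      (\<exists>U\<in>sets borel. emeasure lborel U \<le> ennreal (C * (real N powr (3 + \<delta>) / A powr 4)) \<and>
        (\<forall>x y z. (x, y) \<in> slice t z \<longrightarrow> A \<le> norm (gauss_sum x y N) \<longrightarrow> z \<in> U))"
proof -
  obtain C where C: "C \<ge> 0" "\<And>N Q A. N > 0 \<Longrightarrow> 2 * N \<le> Q \<Longrightarrow> A > 0 \<Longrightarrow>
    24 * real Q * (1 + ln (real Q)) \<le> A\<^sup>2 \<Longrightarrow>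
    \<exists>U\<in>sets borel. emeasure lborel U \<le> ennreal (C * (real N ^ 3 / (A\<^sup>2 * real Q))) \<and>
      (\<forall>x y z. (x, y) \<in> slice t z \<longrightarrow> A \<le> norm (gauss_sum x y N) \<longrightarrow> z \<in> U)"
    using superlevel_cover[OF t] by metis
  show ?thesis
  proof (rule that[of "2 * C"])
    show "2 * C \<ge> 0" using C(1) by simp
    have "\<forall>\<^sub>F N :: nat in at_top. 24 * (1 + 2 * ln (real N)) \<le> real N powr \<delta>"
      using \<delta>(1) by real_asymp
    moreover have "\<forall>\<^sub>F N :: nat in at_top. 2 * real N + 2 \<le> real N powr (5/4)"
      by real_asymp
    moreover have "\<forall>\<^sub>F N :: nat in at_top. N \<ge> 1" by (rule eventually_ge_at_top)
    ultimately show "\<forall>\<^sub>F N in at_top. \<forall>A. real N powr (3/4) \<le> A \<longrightarrow> A \<le> real N \<longrightarrow>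
      (\<exists>U\<in>sets borel. emeasure lborel U \<le> ennreal (2 * C * (real N powr (3 + \<delta>) / A powr 4)) \<and>
        (\<forall>x y z. (x, y) \<in> slice t z \<longrightarrow> A \<le> norm (gauss_sum x y N) \<longrightarrow> z \<in> U))"
    proof eventually_elim
      case (elim N)
      show ?case
      proof (intro allI impI)
        fix A assume A: "real N powr (3/4) \<le> A" "A \<le> real N"
        have N: "real N \<ge> 1" using elim by simp
        have A0: "A > 0" using A(1) N by (smt (verit) powr_gt_zero)
        define T where "T = A\<^sup>2 * real N powr (- \<delta>)"
        define Q where "Q = nat \<lfloor>T\<rfloor>"
        \<comment> \<open>As \<open>\<delta> \<le> 1/4\<close>, the exponent
          \<open>3/2 - \<delta>\<close> is at least \<open>5/4\<close>; this leaves room for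
          \<open>2 * N \<le> Q\<close> after rounding down.\<close>
        have "real N powr (5/4) \<le> real N powr (3/2 - \<delta>)"
          using \<delta> N by (intro powr_mono) auto
        also have "\<dots> = (real N powr (3/4))\<^sup>2 * real N powr (- \<delta>)"
          using N by (simp add: powr_power powr_add[symmetric])
        also have "\<dots> \<le> T"
          unfolding T_def using A(1) by (intro mult_right_mono power_mono) auto
        finally have T: "2 * real N + 2 \<le> T" using elim(2) by simp
        have Q: "real Q \<le> T" "real Q \<ge> T - 1" using T by (auto simp: Q_def)
        have QN: "2 * N \<le> Q" using T Q(2) by linarith
        have TA: "T * real N powr \<delta> = A\<^sup>2"
          using N by (simp add: T_def mult.assoc powr_add[symmetric])
        have "real N powr (- \<delta>) \<le> real N powr 0" using \<delta> N by (intro powr_mono) auto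
        then have "T \<le> A\<^sup>2 * 1" unfolding T_def using N by (intro mult_left_mono) auto
        also have "\<dots> \<le> (real N)\<^sup>2" using A A0 by (simp add: power_mono)
        finally have "real Q \<le> (real N)\<^sup>2" using Q by linarith
        moreover have Q0: "real Q > 0" using QN elim(3) by simp
        ultimately have "ln (real Q) \<le> ln ((real N)\<^sup>2)" by (simp only: ln_mono)
        also have "\<dots> = 2 * ln (real N)" using N by (simp add: ln_realpow)
        finally have lnQ: "ln (real Q) \<le> 2 * ln (real N)" .
        have "24 * real Q * (1 + ln (real Q)) = real Q * (24 * (1 + ln (real Q)))" by simp
        also have "\<dots> \<le> T * real N powr \<delta>"
        proof (rule mult_mono)
          show "24 * (1 + ln (real Q)) \<le> real N powr \<delta>" using lnQ elim(1) by (simp add: algebra_simps)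
          show "0 \<le> 24 * (1 + ln (real Q))" using Q0 by (simp add: add_nonneg_nonneg)
        qed (use Q T N in auto)
        also have "\<dots> = A\<^sup>2" by (rule TA)
        finally have "24 * real Q * (1 + ln (real Q)) \<le> A\<^sup>2" .
        then obtain U where U: "U \<in> sets borel"
          "emeasure lborel U \<le> ennreal (C * (real N ^ 3 / (A\<^sup>2 * real Q)))"
          "\<forall>x y z. (x, y) \<in> slice t z \<longrightarrow> A \<le> norm (gauss_sum x y N) \<longrightarrow> z \<in> U"
          using C(2)[of N Q A] QN A0 elim(3) by auto
        \<comment> \<open>Rounding \<open>T\<close> down loses at most a factor 2, the source of
          \<open>2 * C\<close>.\<close>
        have "T / 2 \<le> real Q" using Q T by linarith
        then have "real N ^ 3 / (A\<^sup>2 * real Q) \<le> real N ^ 3 / (A\<^sup>2 * (T / 2))"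
          using A0 T Q0 by (intro divide_left_mono mult_left_mono) auto
        also have "\<dots> = 2 * (real N ^ 3 * real N powr \<delta> / (A\<^sup>2 * (T * real N powr \<delta>)))"
          using N by simp
        also have "\<dots> = 2 * (real N powr (3 + \<delta>) / A powr 4)"
          using N A0 unfolding TA by (simp add: powr_add powr_numeral power2_eq_square power4_eq_xxxx mult.assoc)
        finally have "C * (real N ^ 3 / (A\<^sup>2 * real Q)) \<le> C * (2 * (real N powr (3 + \<delta>) / A powr 4))"
          using C(1) by (rule mult_left_mono)
        then have "ennreal (C * (real N ^ 3 / (A\<^sup>2 * real Q))) \<le> ennreal (2 * C * (real N powr (3 + \<delta>) / A powr 4))"
          by (intro ennreal_leI) (simp add: mult_ac)
        then show "\<exists>U\<in>sets borel. emeasure lborel U \<le> ennreal (2 * C * (real N powr (3 + \<delta>) / A powr 4)) \<and>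
          (\<forall>x y z. (x, y) \<in> slice t z \<longrightarrow> A \<le> norm (gauss_sum x y N) \<longrightarrow> z \<in> U)"
          using U by (meson order_trans)
      qed
    qed
  qed
qed

section \<open>Integration over layers and conclusion\<close>

lemma norm_gauss_sum_le: "norm (gauss_sum x y N) \<le> real N"
proof -
  have "norm (gauss_sum x y N) \<le> of_nat (card {1..N}) * 1"
    unfolding gauss_sum_def by (rule sum_norm_bound) simp
  then show ?thesis by simp
qed

text \<open>At the first \<open>J\<close> with \<open>g \<le> B J\<close>, either
  \<open>J = 0\<close> or \<open>g > B (J - 1)\<close> puts \<open>z\<close> into
  \<open>U (J - 1)\<close>; a single summand then dominates. The set \<open>S\<close> confines the
  lowest layer to a bounded range.\<close>

lemma slice_sup_le_layers:
  fixes B :: "nat \<Rightarrow> real" and U :: "nat \<Rightarrow> real set"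
  assumes \<rho>: "\<rho> > 0" and top: "real N \<le> B K"
    and S: "\<And>x y. (x, y) \<in> slice t z \<Longrightarrow> z \<in> S"
    and U: "\<And>k x y. k < K \<Longrightarrow> (x, y) \<in> slice t z \<Longrightarrow> B k \<le> norm (gauss_sum x y N) \<Longrightarrow> z \<in> U k"
  shows "slice_sup t \<rho> N z \<le> B 0 powr \<rho> * indicator S z + (\<Sum>k<K. B (Suc k) powr \<rho> * indicator (U k) z)"
proof (cases "slice t z = {}")
  case True
  then show ?thesis by (auto simp: slice_sup_def intro!: add_nonneg_nonneg sum_nonneg)
next
  case False
  obtain x y where xy: "(x, y) \<in> slice t z"
    and eq: "slice_sup t \<rho> N z = norm (gauss_sum x y N) powr \<rho>"
    using slice_sup_attained[OF \<rho> False, of N] by metis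
  define g where "g = norm (gauss_sum x y N)"
  have "g powr \<rho> \<le> B 0 powr \<rho> * indicator S z + (\<Sum>k<J. B (Suc k) powr \<rho> * indicator (U k) z)"
    if "J \<le> K" "g \<le> B J" for J
    using that
  proof (induction J)
    case 0
    then show ?case using S[OF xy] \<rho> by (auto simp: g_def intro: powr_mono2)
  next
    case (Suc J)
    let ?s = "B 0 powr \<rho> * indicator S z + (\<Sum>k<J. B (Suc k) powr \<rho> * indicator (U k) z)"
    show ?case
    proof (cases "g \<le> B J")
      case True
      then have "g powr \<rho> \<le> ?s" using Suc.IH Suc.prems by linarith
      moreover have "0 \<le> B (Suc J) powr \<rho> * indicator (U J) z" by simp
      ultimately show ?thesis unfolding sum.lessThan_Suc by linarith
    next
      case False
      then have "z \<in> U J" using U[of J x y] xy Suc.prems by (simp add: g_def)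
      moreover have "g powr \<rho> \<le> B (Suc J) powr \<rho>"
        using Suc.prems \<rho> by (intro powr_mono2) (auto simp: g_def)
      moreover have "?s \<ge> 0" by (intro add_nonneg_nonneg sum_nonneg) auto
      ultimately show ?thesis by simp
    qed
  qed
  from this[of K] show ?thesis
    using norm_gauss_sum_le[of x y N] top eq by (simp add: g_def)
qed

lemma integral_slice_sup_le_layers:
  fixes B \<mu> :: "nat \<Rightarrow> real" and U :: "nat \<Rightarrow> real set"
  assumes \<rho>: "\<rho> > 0" and top: "real N \<le> B K"
    and U: "\<And>k. k < K \<Longrightarrow> U k \<in> sets borel" "\<And>k. k < K \<Longrightarrow> emeasure lborel (U k) \<le> ennreal (\<mu> k)"
      "\<And>k. k < K \<Longrightarrow> 0 \<le> \<mu> k"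
      "\<And>k x y z. k < K \<Longrightarrow> (x, y) \<in> slice t z \<Longrightarrow> B k \<le> norm (gauss_sum x y N) \<Longrightarrow> z \<in> U k"
  shows "(\<integral>z. slice_sup t \<rho> N z \<partial>lborel) \<le>
    2 * (1 + \<bar>t\<bar>) * B 0 powr \<rho> + (\<Sum>k<K. B (Suc k) powr \<rho> * \<mu> k)"
proof -
  define S where "S = {- (1 + \<bar>t\<bar>)..1 + \<bar>t\<bar>}"
  have S: "emeasure lborel S = ennreal (2 * (1 + \<bar>t\<bar>))" by (simp add: S_def)
  have iS: "integrable lborel (\<lambda>z. indicator S z :: real)"
    by (simp add: integrable_indicator_iff S) (simp add: S_def)
  have iU: "integrable lborel (\<lambda>z. indicator (U k) z :: real)" if "k < K" for k
    using U(1,2)[OF that] by (simp add: integrable_indicator_iff order.strict_trans1)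
  have mU: "measure lborel (U k) \<le> \<mu> k" if "k < K" for k
    using U(2,3)[OF that] by (simp add: measure_def enn2real_leI)
  have "(\<integral>z. slice_sup t \<rho> N z \<partial>lborel) \<le>
      (\<integral>z. B 0 powr \<rho> * indicator S z + (\<Sum>k<K. B (Suc k) powr \<rho> * indicator (U k) z) \<partial>lborel)"
  proof (rule integral_mono)
    show "integrable lborel (slice_sup t \<rho> N)" by (rule integrable_slice_sup[OF \<rho>])
    show "integrable lborel (\<lambda>z. B 0 powr \<rho> * indicator S z + (\<Sum>k<K. B (Suc k) powr \<rho> * indicator (U k) z))"
      using iS iU by (intro Bochner_Integration.integrable_add Bochner_Integration.integrable_sum integrable_mult_right) auto
    fix z
    show "slice_sup t \<rho> N z \<le> B 0 powr \<rho> * indicator S z + (\<Sum>k<K. B (Suc k) powr \<rho> * indicator (U k) z)"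
    proof (rule slice_sup_le_layers[where B = B, OF \<rho> top])
      fix x y assume "(x, y) \<in> slice t z"
      then show "z \<in> S" using slice_abs_le(2) by (force simp: S_def)
    qed (use U(4) in blast)
  qed
  also have "\<dots> = B 0 powr \<rho> * measure lborel S + (\<Sum>k<K. B (Suc k) powr \<rho> * measure lborel (U k))"
  proof -
    have "integrable lborel (\<lambda>z. B (Suc k) powr \<rho> * indicator (U k) z)" if "k < K" for k
      using iU[OF that] by (rule integrable_mult_right)
    then have "integrable lborel (\<lambda>z. \<Sum>k<K. B (Suc k) powr \<rho> * indicator (U k) z)"
      and "(\<integral>z. (\<Sum>k<K. B (Suc k) powr \<rho> * indicator (U k) z) \<partial>lborel) =
        (\<Sum>k<K. \<integral>z. B (Suc k) powr \<rho> * indicator (U k) z \<partial>lborel)"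
      by (auto intro!: Bochner_Integration.integrable_sum Bochner_Integration.integral_sum
          simp del: sum_mult_indicator)
    then show ?thesis
      using iS by (subst Bochner_Integration.integral_add) auto
  qed
  also have "measure lborel S = 2 * (1 + \<bar>t\<bar>)" using S by (simp add: measure_def)
  also have "B 0 powr \<rho> * (2 * (1 + \<bar>t\<bar>)) + (\<Sum>k<K. B (Suc k) powr \<rho> * measure lborel (U k))
      \<le> 2 * (1 + \<bar>t\<bar>) * B 0 powr \<rho> + (\<Sum>k<K. B (Suc k) powr \<rho> * \<mu> k)"
    using mU by (intro add_mono sum_mono mult_left_mono) auto
  finally show ?thesis .
qed

theorem theorem1p6:
  fixes t \<rho> :: real
  assumes "t \<in> \<rat>" and "\<rho> > 0"
  shows "\<forall>\<epsilon>>0. \<forall>\<^sub>F N in at_top.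
           P_norm t \<rho> N \<le> real N powr (3/4 + \<epsilon>) + real N powr (1 - 1/\<rho> + \<epsilon>)"
proof (intro allI impI)
  fix \<epsilon> :: real assume \<epsilon>: "\<epsilon> > 0"
  \<comment> \<open>The losses are \<open>\<delta> * \<rho>\<close> from the ratio of consecutive
    levels, \<open>\<delta>\<close> from the cover, and \<open>\<delta>\<close> for absorbing
    constants, together at most \<open>\<epsilon> * \<rho>\<close>. The cap 1/4 is required by the
    cover.\<close>
  define \<delta> where "\<delta> = min (1/4) (\<epsilon> * \<rho> / (\<rho> + 2))"
  have \<delta>: "0 < \<delta>" "\<delta> \<le> 1/4"
    unfolding \<delta>_def using \<epsilon> assms(2) by (simp, intro min.cobounded1)
  have "\<delta> \<le> \<epsilon> * \<rho> / (\<rho> + 2)" by (simp add: \<delta>_def)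
  then have \<delta>\<epsilon>: "\<delta> * (\<rho> + 2) \<le> \<epsilon> * \<rho>" using assms(2) by (simp add: pos_le_divide_eq)
  \<comment> \<open>Levels rise from \<open>N powr (3/4)\<close> in steps of
    \<open>N powr \<delta>\<close>. This \<open>K\<close> is the first index whose level reaches
    \<open>N\<close>, so every \<open>k < K\<close> stays in the range where the cover is
    available.\<close>
  define K where "K = nat \<lceil>1 / (4 * \<delta>)\<rceil>"
  have K: "real K * \<delta> \<ge> 1/4"
  proof -
    have "real K \<ge> 1 / (4 * \<delta>)" by (simp add: K_def real_nat_ceiling_ge)
    then show ?thesis using \<delta>(1) by (simp add: field_simps)
  qed
  have kK: "real k * \<delta> \<le> 1/4" if "k < K" for k
  proof -
    have "real k < 1 / (4 * \<delta>)" using that unfolding K_def by linarith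
    then show ?thesis using \<delta>(1) by (simp add: field_simps)
  qed
  define E where "E = max (3/4 * \<rho>) (\<rho> - 1)"
  obtain C where C: "C \<ge> 0" "\<forall>\<^sub>F N in at_top. \<forall>A. real N powr (3/4) \<le> A \<longrightarrow> A \<le> real N \<longrightarrow>
      (\<exists>U\<in>sets borel. emeasure lborel U \<le> ennreal (C * (real N powr (3 + \<delta>) / A powr 4)) \<and>
        (\<forall>x y z. (x, y) \<in> slice t z \<longrightarrow> A \<le> norm (gauss_sum x y N) \<longrightarrow> z \<in> U))"
    by (rule superlevel_cover_powr[OF assms(1) \<delta>])
  define M where "M = 2 * (1 + \<bar>t\<bar>) + real K * C"
  have "\<forall>\<^sub>F N :: nat in at_top. M \<le> real N powr \<delta>" using \<delta>(1) by real_asymp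
  moreover have "\<forall>\<^sub>F N :: nat in at_top. N \<ge> 1" by (rule eventually_ge_at_top)
  ultimately show "\<forall>\<^sub>F N in at_top.
      P_norm t \<rho> N \<le> real N powr (3/4 + \<epsilon>) + real N powr (1 - 1/\<rho> + \<epsilon>)"
    using C(2)
  proof eventually_elim
    case (elim N)
    have N: "real N \<ge> 1" using elim(2) by simp
    define B where "B k = real N powr (3/4 + real k * \<delta>)" for k
    define \<mu> where "\<mu> k = C * (real N powr (3 + \<delta>) / B k powr 4)" for k
    have "\<exists>U. U \<in> sets borel \<and> emeasure lborel U \<le> ennreal (\<mu> k) \<and>
        (\<forall>x y z. (x, y) \<in> slice t z \<longrightarrow> B k \<le> norm (gauss_sum x y N) \<longrightarrow> z \<in> U)" if "k < K" for k
    proof -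
      have "real N powr (3/4) \<le> B k" unfolding B_def using N \<delta> by (intro powr_mono) auto
      moreover have "B k \<le> real N powr 1"
        unfolding B_def using N kK[OF that] by (intro powr_mono) auto
      ultimately show ?thesis using elim(3)[rule_format, of "B k"] N unfolding \<mu>_def by auto
    qed
    then obtain U where U: "\<And>k. k < K \<Longrightarrow> U k \<in> sets borel"
      "\<And>k. k < K \<Longrightarrow> emeasure lborel (U k) \<le> ennreal (\<mu> k)"
      "\<And>k x y z. k < K \<Longrightarrow> (x, y) \<in> slice t z \<Longrightarrow> B k \<le> norm (gauss_sum x y N) \<Longrightarrow> z \<in> U k"
      by metis
    have "real N powr 1 \<le> B K" unfolding B_def using N K by (intro powr_mono) auto
    then have "(\<integral>z. slice_sup t \<rho> N z \<partial>lborel) \<le>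
        2 * (1 + \<bar>t\<bar>) * B 0 powr \<rho> + (\<Sum>k<K. B (Suc k) powr \<rho> * \<mu> k)"
      using N U C(1)
      by (intro integral_slice_sup_le_layers[where U = U, OF assms(2)]) (auto simp: \<mu>_def)
    also have "\<dots> \<le> 2 * (1 + \<bar>t\<bar>) * real N powr (E + \<delta> * (\<rho> + 1)) +
        (\<Sum>k<K. C * real N powr (E + \<delta> * (\<rho> + 1)))"
    proof (intro add_mono mult_left_mono sum_mono)
      have "0 \<le> \<delta> * (\<rho> + 1)" "3/4 * \<rho> \<le> E" using \<delta> assms(2) by (auto simp: E_def)
      then have "3/4 * \<rho> \<le> E + \<delta> * (\<rho> + 1)" by linarith
      then have "real N powr (3/4 * \<rho>) \<le> real N powr (E + \<delta> * (\<rho> + 1))"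
        using N by (intro powr_mono) auto
      then show "B 0 powr \<rho> \<le> real N powr (E + \<delta> * (\<rho> + 1))"
        by (simp add: B_def powr_powr)
    next
      fix k assume "k \<in> {..<K}"
      then have k: "0 \<le> real k * \<delta>" "real k * \<delta> \<le> 1/4" using kK \<delta> by auto
      \<comment> \<open>The exponent is affine in \<open>k * \<delta>\<close> on
        \<open>[0, 1/4]\<close>, so its maximum is at an endpoint: \<open>3/4 * \<rho>\<close> at 0,
        \<open>\<rho> - 1\<close> at 1/4. The sign of \<open>\<rho> - 4\<close> decides
        which.\<close>
      have "3/4 * \<rho> + real k * \<delta> * (\<rho> - 4) \<le> E"
      proof (cases "\<rho> \<le> 4")
        case True
        then have "real k * \<delta> * (\<rho> - 4) \<le> 0" using k by (intro mult_nonneg_nonpos) auto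
        then show ?thesis by (simp add: E_def)
      next
        case False
        then have "real k * \<delta> * (\<rho> - 4) \<le> 1/4 * (\<rho> - 4)" using k by (intro mult_right_mono) auto
        then show ?thesis by (simp add: E_def)
      qed
      then have exponent: "(3/4 + real (Suc k) * \<delta>) * \<rho> + (3 + \<delta>) - (3/4 + real k * \<delta>) * 4
          \<le> E + \<delta> * (\<rho> + 1)"
        by (simp add: algebra_simps)
      have "B (Suc k) powr \<rho> * (real N powr (3 + \<delta>) / B k powr 4) =
          real N powr ((3/4 + real (Suc k) * \<delta>) * \<rho> + (3 + \<delta>) - (3/4 + real k * \<delta>) * 4)"
        unfolding B_def powr_powr powr_diff
          powr_add[of "real N" "(3/4 + real (Suc k) * \<delta>) * \<rho>" "3 + \<delta>"] by simp
      also have "\<dots> \<le> real N powr (E + \<delta> * (\<rho> + 1))"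
        using N exponent by (intro powr_mono) auto
      finally have "C * (B (Suc k) powr \<rho> * (real N powr (3 + \<delta>) / B k powr 4)) \<le>
          C * real N powr (E + \<delta> * (\<rho> + 1))" using C(1) by (rule mult_left_mono)
      then show "B (Suc k) powr \<rho> * \<mu> k \<le> C * real N powr (E + \<delta> * (\<rho> + 1))"
        by (simp add: \<mu>_def mult_ac)
    qed auto
    also have "\<dots> = M * real N powr (E + \<delta> * (\<rho> + 1))" by (simp add: M_def algebra_simps)
    also have "\<dots> \<le> real N powr \<delta> * real N powr (E + \<delta> * (\<rho> + 1))"
      using elim(1) by (intro mult_right_mono) auto
    also have "\<dots> = real N powr (E + \<delta> * (\<rho> + 2))"
      by (simp add: powr_add[symmetric] algebra_simps)
    also have "\<dots> \<le> real N powr (E + \<epsilon> * \<rho>)" using N \<delta>\<epsilon> by (intro powr_mono) auto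
    finally have I: "(\<integral>z. slice_sup t \<rho> N z \<partial>lborel) \<le> real N powr (E + \<epsilon> * \<rho>)" .
    have "P_norm t \<rho> N \<le> (real N powr (E + \<epsilon> * \<rho>)) powr (1 / \<rho>)"
      unfolding P_norm_def using I assms(2) slice_sup_nonneg[OF assms(2)]
      by (intro powr_mono2 integral_nonneg) auto
    also have "\<dots> = real N powr (E / \<rho> + \<epsilon>)"
      using assms(2) by (simp add: powr_powr add_divide_distrib)
    also have "\<dots> \<le> real N powr (3/4 + \<epsilon>) + real N powr (1 - 1/\<rho> + \<epsilon>)"
    \<comment> \<open>\<open>E / \<rho>\<close> is the larger of \<open>3/4\<close> and
      \<open>1 - 1/\<rho>\<close>, so one of the two powers already suffices.\<close>
    proof (cases "3/4 * \<rho> \<le> \<rho> - 1")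
      case True
      then have "E / \<rho> = 1 - 1/\<rho>" using assms(2) by (simp add: E_def field_simps)
      then show ?thesis by simp
    next
      case False
      then have "E / \<rho> = 3/4" using assms(2) by (simp add: E_def field_simps)
      then show ?thesis by (simp only: le_add_same_cancel1 powr_ge_zero)
    qed
    finally show ?case .
  qed
qed

end
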